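(* Let $\Delta = n^2 - 4$ with an integer $n \ge 0$ such that $\Delta$ is a quadratic discriminant, and let $h_\Delta$ be the (wide) class number of the order $\mathcal{O}_\Delta$. (1) If $\mathcal{O}_\Delta$ is a maximal order, $n = 2m$ is even, and $h_\Delta = 1$, then $m \in \{0, 2\}$, so $n \in \{0,4\}$ and $\Delta \in \{-4, 12\}$. (2) If $n \equiv 2 \pmod 4$, write $n = 2m$; if $m > 3$, then $h_\Delta$ is even (whether or not $\mathcal{O}_\Delta$ is maximal). For $m = 3$, i.e. $\Delta = 32$, one has $h_\Delta = 1$.
   Context: A quadratic discriminant is a nonsquare integer $\equiv 0,1\pmod 4$. For such $\Delta$, $\mathcal{O}_\Delta = \mathbb{Z}[\frac{\Delta+\sqrt\Delta}{2}]$ is the quadratic order of discriminant $\Delta$; it is maximal iff $\Delta$ is a fundamental discriminant. The (wide) class number $h_\Delta$ is the order of the group of invertible fractional ideals of $\mathcal{O}_\Delta$ modulo principal fractional ideals. *)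

theory Defs
  imports Complex_Main "HOL-Algebra.Coset" "HOL-Computational_Algebra.Polynomial"
begin

definition quad_discriminant :: "int \<Rightarrow> bool" where
  "quad_discriminant \<Delta> \<longleftrightarrow> (\<nexists>k. \<Delta> = k\<^sup>2) \<and> (\<Delta> mod 4 = 0 \<or> \<Delta> mod 4 = 1)"

text \<open>The field \<open>\<rat>(\<surd>\<Delta>)\<close> is realised inside the complex numbers.\<close>

definition quad_field :: "int \<Rightarrow> complex set" where
  "quad_field \<Delta> = {of_rat a + of_rat b * csqrt (of_int \<Delta>) | a b. True}"

definition quad_gen :: "int \<Rightarrow> complex" where
  "quad_gen \<Delta> = (of_int \<Delta> + csqrt (of_int \<Delta>)) / 2"

definition quad_order :: "int \<Rightarrow> complex set" where
  "quad_order \<Delta> = {poly (map_poly of_int p) (quad_gen \<Delta>) | p :: int poly. True}"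

text \<open>The conditions say: subring of the field, finitely generated as a \<open>\<int>\<close>-module,
  spanning the field over \<open>\<rat>\<close>.\<close>

definition order_in_quad_field :: "int \<Rightarrow> complex set \<Rightarrow> bool" where
  "order_in_quad_field \<Delta> R \<longleftrightarrow>
     R \<subseteq> quad_field \<Delta> \<and> 1 \<in> R \<and> (\<forall>x\<in>R. \<forall>y\<in>R. x - y \<in> R \<and> x * y \<in> R) \<and>
     (\<exists>B. finite B \<and> R = {\<Sum>b\<in>B. of_int (c b) * b | c. True}) \<and>
     quad_field \<Delta> = {of_rat q * x | q x. x \<in> R}"

definition maximal_order :: "int \<Rightarrow> complex set \<Rightarrow> bool" where
  "maximal_order \<Delta> R \<longleftrightarrow>
     order_in_quad_field \<Delta> R \<and> (\<forall>S. order_in_quad_field \<Delta> S \<and> R \<subseteq> S \<longrightarrow> S = R)"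

definition fractional_ideal :: "int \<Rightarrow> complex set \<Rightarrow> bool" where
  "fractional_ideal \<Delta> I \<longleftrightarrow>
     I \<subseteq> quad_field \<Delta> \<and> 0 \<in> I \<and> I \<noteq> {0} \<and>
     (\<forall>x\<in>I. \<forall>y\<in>I. x + y \<in> I) \<and> (\<forall>r\<in>quad_order \<Delta>. \<forall>x\<in>I. r * x \<in> I) \<and>
     (\<exists>d\<in>quad_order \<Delta>. d \<noteq> 0 \<and> (\<forall>x\<in>I. d * x \<in> quad_order \<Delta>))"

definition ideal_mult :: "complex set \<Rightarrow> complex set \<Rightarrow> complex set" where
  "ideal_mult I J = {(\<Sum>(x, y)\<leftarrow>ps. x * y) | ps. set ps \<subseteq> I \<times> J}"

definition invertible_ideal_group :: "int \<Rightarrow> complex set monoid" where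
  "invertible_ideal_group \<Delta> =
     \<lparr>carrier = {I. fractional_ideal \<Delta> I \<and>
                    (\<exists>J. fractional_ideal \<Delta> J \<and> ideal_mult I J = quad_order \<Delta>)},
      monoid.mult = ideal_mult, one = quad_order \<Delta>\<rparr>"

definition principal_ideals :: "int \<Rightarrow> complex set set" where
  "principal_ideals \<Delta> = {(*) x ` quad_order \<Delta> | x. x \<in> quad_field \<Delta> \<and> x \<noteq> 0}"

definition class_group :: "int \<Rightarrow> complex set set monoid" where
  "class_group \<Delta> = invertible_ideal_group \<Delta> Mod principal_ideals \<Delta>"

definition class_number :: "int \<Rightarrow> nat" where
  "class_number \<Delta> = Coset.order (class_group \<Delta>)"

lemma csqrt_sq [simp]: "csqrt z * csqrt z = z"
  by (metis power2_csqrt power2_eq_square)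

lemma quad_field_Rat: "of_rat a \<in> quad_field \<Delta>"
  unfolding quad_field_def by (rule CollectI, rule exI[of _ a], rule exI[of _ 0]) simp

lemma quad_field_add: "x \<in> quad_field \<Delta> \<Longrightarrow> y \<in> quad_field \<Delta> \<Longrightarrow> x + y \<in> quad_field \<Delta>"
  unfolding quad_field_def
proof clarify
  fix a b c d :: rat
  show "\<exists>e f. of_rat a + of_rat b * csqrt (of_int \<Delta>) + (of_rat c + of_rat d * csqrt (of_int \<Delta>))
      = of_rat e + of_rat f * csqrt (of_int \<Delta>) \<and> True"
    by (rule exI[of _ "a + c"], rule exI[of _ "b + d"]) (simp add: of_rat_add algebra_simps)
qed

lemma quad_field_mult: "x \<in> quad_field \<Delta> \<Longrightarrow> y \<in> quad_field \<Delta> \<Longrightarrow> x * y \<in> quad_field \<Delta>"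
  unfolding quad_field_def
proof clarify
  fix a b c d :: rat
  let ?s = "csqrt (of_int \<Delta>)"
  have "(of_rat a + of_rat b * ?s) * (of_rat c + of_rat d * ?s)
      = of_rat a * of_rat c + of_rat b * of_rat d * (?s * ?s)
        + (of_rat a * of_rat d + of_rat b * of_rat c) * ?s"
    by (simp add: algebra_simps del: csqrt_sq)
  also have "\<dots> = of_rat (a * c + b * d * of_int \<Delta>) + of_rat (a * d + b * c) * ?s"
    by (simp add: of_rat_add of_rat_mult)
  finally show "\<exists>e f. (of_rat a + of_rat b * ?s) * (of_rat c + of_rat d * ?s)
      = of_rat e + of_rat f * ?s \<and> True"
    by blast
qed

lemma quad_field_inverse:
  assumes "x \<in> quad_field \<Delta>"
  shows "inverse x \<in> quad_field \<Delta>"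
proof -
  let ?s = "csqrt (of_int \<Delta>)"
  obtain a b where x: "x = of_rat a + of_rat b * ?s"
    using assms unfolding quad_field_def by blast
  define y where "y = of_rat a + of_rat (- b) * ?s"
  have yK: "y \<in> quad_field \<Delta>" unfolding y_def quad_field_def by blast
  have "x * y = of_rat a * of_rat a - of_rat b * of_rat b * (?s * ?s)"
    by (simp add: x y_def of_rat_minus algebra_simps del: csqrt_sq)
  then have xy: "x * y = of_rat (a * a - b * b * of_int \<Delta>)"
    by (simp add: of_rat_diff of_rat_mult)
  show ?thesis
  proof (cases "y = 0")
    case True
    then have "of_rat b * ?s = of_rat a" by (simp add: y_def of_rat_minus)
    then have "x = of_rat (a + a)" unfolding x of_rat_add by simp
    then have "inverse x = of_rat (inverse (a + a))" by (simp only: of_rat_inverse)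
    then show ?thesis using quad_field_Rat by metis
  next
    case False
    then have "inverse x = y * inverse (x * y)" by simp
    also have "\<dots> = y * of_rat (inverse (a * a - b * b * of_int \<Delta>))"
      by (simp only: xy of_rat_inverse)
    finally show ?thesis using quad_field_mult[OF yK quad_field_Rat] by metis
  qed
qed

lemma of_int_poly_add:
  "map_poly of_int (p + q) = map_poly of_int p + (map_poly of_int q :: complex poly)"
  by (rule poly_eqI) (simp add: coeff_map_poly)

lemma of_int_poly_mult:
  "map_poly of_int (p * q) = map_poly of_int p * (map_poly of_int q :: complex poly)"
  by (rule poly_eqI) (simp add: coeff_map_poly coeff_mult)

lemma quad_order_add: "x \<in> quad_order \<Delta> \<Longrightarrow> y \<in> quad_order \<Delta> \<Longrightarrow> x + y \<in> quad_order \<Delta>"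
  unfolding quad_order_def by (clarify, metis of_int_poly_add poly_add)

lemma quad_order_mult: "x \<in> quad_order \<Delta> \<Longrightarrow> y \<in> quad_order \<Delta> \<Longrightarrow> x * y \<in> quad_order \<Delta>"
  unfolding quad_order_def by (clarify, metis of_int_poly_mult poly_mult)

lemma quad_order_int: "of_int a \<in> quad_order \<Delta>"
  unfolding quad_order_def by (rule CollectI, rule exI[of _ "[:a:]"]) (simp add: map_poly_pCons)

lemma quad_order_0: "0 \<in> quad_order \<Delta>" and quad_order_1: "1 \<in> quad_order \<Delta>"
  using quad_order_int[of 0] quad_order_int[of 1] by simp_all

lemma quad_gen_in_order: "quad_gen \<Delta> \<in> quad_order \<Delta>"
  unfolding quad_order_def by (rule CollectI, rule exI[of _ "[:0, 1:]"]) (simp add: map_poly_pCons)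

lemma quad_order_subset_field: "quad_order \<Delta> \<subseteq> quad_field \<Delta>"
proof
  have gen: "quad_gen \<Delta> \<in> quad_field \<Delta>"
    unfolding quad_field_def quad_gen_def
    by (rule CollectI, rule exI[of _ "of_int \<Delta> / 2"], rule exI[of _ "1 / 2"])
      (simp add: of_rat_divide field_simps)
  have "poly (map_poly of_int p) (quad_gen \<Delta>) \<in> quad_field \<Delta>" for p :: "int poly"
  proof (induction p)
    case 0
    then show ?case using quad_field_Rat[of 0] by simp
  next
    case (pCons a p)
    then show ?case
      using quad_field_add[OF quad_field_Rat[of "of_int a"] quad_field_mult[OF gen pCons.IH]]
      by (simp add: map_poly_pCons)
  qed
  then show "x \<in> quad_field \<Delta>" if "x \<in> quad_order \<Delta>" for x
    using that unfolding quad_order_def by blast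
qed

lemma quad_order_eq:
  assumes "quad_discriminant \<Delta>"
  shows "quad_order \<Delta> = {of_int a + of_int b * quad_gen \<Delta> | a b. True}"
proof
  let ?w = "quad_gen \<Delta>"
  have "(\<Delta> * \<Delta> - \<Delta>) mod 4 = 0"
  proof -
    from assms consider "\<Delta> mod 4 = 0" | "\<Delta> mod 4 = 1"
      unfolding quad_discriminant_def by blast
    then have "\<Delta> * \<Delta> mod 4 = \<Delta> mod 4"
      by cases (simp_all add: mod_mult_eq[of \<Delta> 4 \<Delta>, symmetric])
    then show ?thesis by (simp add: mod_eq_dvd_iff)
  qed
  then obtain c where c: "\<Delta> * \<Delta> - \<Delta> = 4 * c"
    by (meson dvdE mod_0_imp_dvd)
  have "4 * (?w * ?w) = 4 * (of_int \<Delta> * ?w) - (of_int \<Delta> * of_int \<Delta> - of_int \<Delta>)"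
    by (simp add: quad_gen_def field_simps)
  also have "of_int \<Delta> * of_int \<Delta> - of_int \<Delta> = (of_int (4 * c) :: complex)"
    by (simp flip: c)
  finally have "4 * (?w * ?w) = 4 * (of_int \<Delta> * ?w - of_int c)" by (simp add: algebra_simps)
  then have w2: "?w * ?w = of_int \<Delta> * ?w - of_int c"
    by (metis mult_cancel_left zero_neq_numeral)
  have "\<exists>a b. poly (map_poly of_int p) ?w = of_int a + of_int b * ?w" for p :: "int poly"
  proof (induction p)
    case 0
    show ?case by (rule exI[of _ 0], rule exI[of _ 0]) simp
  next
    case (pCons a p)
    then obtain u v where uv: "poly (map_poly of_int p) ?w = of_int u + of_int v * ?w" by blast
    have "poly (map_poly of_int (pCons a p)) ?w = of_int a + of_int u * ?w + of_int v * (?w * ?w)"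
      using uv by (simp add: map_poly_pCons algebra_simps)
    also have "\<dots> = of_int (a - v * c) + of_int (u + v * \<Delta>) * ?w"
      unfolding w2 by (simp add: algebra_simps)
    finally show ?case by blast
  qed
  then show "quad_order \<Delta> \<subseteq> {of_int a + of_int b * ?w | a b. True}"
    unfolding quad_order_def by blast
  show "{of_int a + of_int b * ?w | a b. True} \<subseteq> quad_order \<Delta>"
    using quad_order_add quad_order_mult quad_order_int quad_gen_in_order by blast
qed

lemma ideal_mult_0: "0 \<in> ideal_mult I J"
  unfolding ideal_mult_def by (rule CollectI, rule exI[of _ "[]"]) simp

lemma ideal_mult_prod: "x \<in> I \<Longrightarrow> y \<in> J \<Longrightarrow> x * y \<in> ideal_mult I J"
  unfolding ideal_mult_def by (rule CollectI, rule exI[of _ "[(x, y)]"]) simp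

lemma ideal_mult_add:
  assumes "x \<in> ideal_mult I J" "y \<in> ideal_mult I J"
  shows "x + y \<in> ideal_mult I J"
proof -
  obtain ps qs where "x = (\<Sum>(x, y)\<leftarrow>ps. x * y)" "set ps \<subseteq> I \<times> J"
    "y = (\<Sum>(x, y)\<leftarrow>qs. x * y)" "set qs \<subseteq> I \<times> J"
    using assms unfolding ideal_mult_def by blast
  then show ?thesis
    unfolding ideal_mult_def by (intro CollectI exI[of _ "ps @ qs"]) simp
qed

lemma ideal_mult_induct [consumes 1, case_names zero add]:
  assumes "z \<in> ideal_mult I J" and "P 0"
    and "\<And>x y z. x \<in> I \<Longrightarrow> y \<in> J \<Longrightarrow> P z \<Longrightarrow> P (x * y + z)"
  shows "P z"
proof -
  obtain ps where z: "z = (\<Sum>(x, y)\<leftarrow>ps. x * y)" and ps: "set ps \<subseteq> I \<times> J"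
    using assms(1) unfolding ideal_mult_def by blast
  from ps have "P (\<Sum>(x, y)\<leftarrow>ps. x * y)"
    by (induction ps) (use assms(2,3) in auto)
  with z show ?thesis by simp
qed

lemma ideal_mult_commute: "ideal_mult I J = ideal_mult J I"
proof -
  have "ideal_mult A B \<subseteq> ideal_mult B A" for A B
  proof
    fix z assume "z \<in> ideal_mult A B"
    then show "z \<in> ideal_mult B A"
    proof (induction rule: ideal_mult_induct)
      case zero
      show ?case by (rule ideal_mult_0)
    next
      case (add x y z)
      then show ?case
        using ideal_mult_add[OF ideal_mult_prod[of y B x A]] by (simp add: mult.commute)
    qed
  qed
  then show ?thesis by blast
qed

lemma ideal_mult_assoc_subset: "ideal_mult (ideal_mult I J) L \<subseteq> ideal_mult I (ideal_mult J L)"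
proof
  have *: "x * y \<in> ideal_mult I (ideal_mult J L)" if "x \<in> ideal_mult I J" "y \<in> L" for x y
    using that(1)
  proof (induction rule: ideal_mult_induct)
    case zero
    then show ?case by (simp add: ideal_mult_0)
  next
    case (add a b z)
    have "a * (b * y) \<in> ideal_mult I (ideal_mult J L)"
      using add that(2) by (intro ideal_mult_prod)
    then have "a * (b * y) + z * y \<in> ideal_mult I (ideal_mult J L)"
      using add by (intro ideal_mult_add)
    then show ?case by (simp add: algebra_simps)
  qed
  fix z assume "z \<in> ideal_mult (ideal_mult I J) L"
  then show "z \<in> ideal_mult I (ideal_mult J L)"
    by (induction rule: ideal_mult_induct) (auto intro: ideal_mult_0 ideal_mult_add *)
qed

lemma ideal_mult_assoc: "ideal_mult (ideal_mult I J) L = ideal_mult I (ideal_mult J L)"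
  using ideal_mult_assoc_subset[of I J L] ideal_mult_assoc_subset[of L J I]
  by (metis ideal_mult_commute subset_antisym)

lemma ideal_mult_one:
  assumes "fractional_ideal \<Delta> I"
  shows "ideal_mult (quad_order \<Delta>) I = I"
proof
  show "ideal_mult (quad_order \<Delta>) I \<subseteq> I"
  proof
    fix z assume "z \<in> ideal_mult (quad_order \<Delta>) I"
    then show "z \<in> I"
      by (induction rule: ideal_mult_induct) (use assms in \<open>auto simp: fractional_ideal_def\<close>)
  qed
  show "I \<subseteq> ideal_mult (quad_order \<Delta>) I"
    using ideal_mult_prod[OF quad_order_1] by fastforce
qed

lemma fractional_ideal_mult:
  assumes I: "fractional_ideal \<Delta> I" and J: "fractional_ideal \<Delta> J"
  shows "fractional_ideal \<Delta> (ideal_mult I J)"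
  unfolding fractional_ideal_def
proof (intro conjI ballI)
  show "ideal_mult I J \<subseteq> quad_field \<Delta>"
  proof
    fix z assume "z \<in> ideal_mult I J"
    then show "z \<in> quad_field \<Delta>"
    proof (induction rule: ideal_mult_induct)
      case zero
      then show ?case using quad_field_Rat[of 0] by simp
    next
      case (add x y z)
      then show ?case
        using I J by (intro quad_field_add quad_field_mult) (auto simp: fractional_ideal_def)
    qed
  qed
  show "0 \<in> ideal_mult I J" by (rule ideal_mult_0)
  have "\<exists>x\<in>A. x \<noteq> 0" if "fractional_ideal \<Delta> A" for A
    using that unfolding fractional_ideal_def by blast
  with I J obtain x y where "x \<in> I" "x \<noteq> 0" "y \<in> J" "y \<noteq> 0" by meson
  then have "x * y \<in> ideal_mult I J" "x * y \<noteq> 0" by (auto intro: ideal_mult_prod)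
  then show "ideal_mult I J \<noteq> {0}" by blast
  show "x + y \<in> ideal_mult I J" if "x \<in> ideal_mult I J" "y \<in> ideal_mult I J" for x y
    using that by (rule ideal_mult_add)
  show "r * x \<in> ideal_mult I J" if r: "r \<in> quad_order \<Delta>" and x: "x \<in> ideal_mult I J" for r x
    using x
  proof (induction rule: ideal_mult_induct)
    case zero
    then show ?case by (simp add: ideal_mult_0)
  next
    case (add a b z)
    have "r * a \<in> I" using I r add by (auto simp: fractional_ideal_def)
    then have "(r * a) * b + r * z \<in> ideal_mult I J"
      using add by (metis ideal_mult_add ideal_mult_prod)
    then show ?case by (simp add: algebra_simps)
  qed
  obtain d where d: "d \<in> quad_order \<Delta>" "d \<noteq> 0" "\<forall>x\<in>I. d * x \<in> quad_order \<Delta>"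
    using I unfolding fractional_ideal_def by meson
  obtain e where e: "e \<in> quad_order \<Delta>" "e \<noteq> 0" "\<forall>x\<in>J. e * x \<in> quad_order \<Delta>"
    using J unfolding fractional_ideal_def by meson
  have "d * e * x \<in> quad_order \<Delta>" if "x \<in> ideal_mult I J" for x
    using that
  proof (induction rule: ideal_mult_induct)
    case zero
    then show ?case by (simp add: quad_order_0)
  next
    case (add a b z)
    then have "(d * a) * (e * b) + d * e * z \<in> quad_order \<Delta>"
      using d e by (auto intro!: quad_order_add quad_order_mult[of "d * a"])
    then show ?case by (simp add: algebra_simps)
  qed
  then show "\<exists>d\<in>quad_order \<Delta>. d \<noteq> 0 \<and> (\<forall>x\<in>ideal_mult I J. d * x \<in> quad_order \<Delta>)"
    using d e quad_order_mult by (intro bexI[of _ "d * e"]) auto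
qed

lemma fractional_ideal_order: "fractional_ideal \<Delta> (quad_order \<Delta>)"
  unfolding fractional_ideal_def
proof (intro conjI ballI)
  show "quad_order \<Delta> \<noteq> {0}" using quad_order_1[of \<Delta>] by auto
  show "\<exists>d\<in>quad_order \<Delta>. d \<noteq> 0 \<and> (\<forall>x\<in>quad_order \<Delta>. d * x \<in> quad_order \<Delta>)"
    using quad_order_1[of \<Delta>] by (intro bexI[of _ 1]) auto
qed (use quad_order_subset_field in \<open>auto simp: quad_order_0 quad_order_add quad_order_mult\<close>)

lemma comm_group_invertible_ideals: "comm_group (invertible_ideal_group \<Delta>)"
proof (rule comm_groupI)
  fix I J L
  let ?G = "invertible_ideal_group \<Delta>"
  show "I \<otimes>\<^bsub>?G\<^esub> J \<in> carrier ?G" if IJ: "I \<in> carrier ?G" "J \<in> carrier ?G"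
  proof -
    obtain I' J' where *: "fractional_ideal \<Delta> I'" "ideal_mult I I' = quad_order \<Delta>"
      "fractional_ideal \<Delta> J'" "ideal_mult J J' = quad_order \<Delta>"
      using IJ unfolding invertible_ideal_group_def by auto
    have "ideal_mult (ideal_mult I J) (ideal_mult J' I') = ideal_mult I (ideal_mult (ideal_mult J J') I')"
      by (simp add: ideal_mult_assoc)
    also have "\<dots> = quad_order \<Delta>" by (simp add: * ideal_mult_one)
    finally show ?thesis
      using IJ * by (auto simp: invertible_ideal_group_def intro: fractional_ideal_mult)
  qed
  show "\<one>\<^bsub>?G\<^esub> \<in> carrier ?G"
    using fractional_ideal_order ideal_mult_one[OF fractional_ideal_order]
    by (auto simp: invertible_ideal_group_def)
  show "I \<otimes>\<^bsub>?G\<^esub> J \<otimes>\<^bsub>?G\<^esub> L = I \<otimes>\<^bsub>?G\<^esub> (J \<otimes>\<^bsub>?G\<^esub> L)"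
    by (simp add: invertible_ideal_group_def ideal_mult_assoc)
  show "I \<otimes>\<^bsub>?G\<^esub> J = J \<otimes>\<^bsub>?G\<^esub> I"
    by (simp add: invertible_ideal_group_def ideal_mult_commute[of I])
  show "\<one>\<^bsub>?G\<^esub> \<otimes>\<^bsub>?G\<^esub> I = I" if "I \<in> carrier ?G"
    using that by (simp add: invertible_ideal_group_def ideal_mult_one)
  show "\<exists>J\<in>carrier ?G. J \<otimes>\<^bsub>?G\<^esub> I = \<one>\<^bsub>?G\<^esub>" if "I \<in> carrier ?G"
    using that ideal_mult_commute by (auto simp: invertible_ideal_group_def)
qed

lemma ideal_mult_principal:
  "ideal_mult ((*) x ` quad_order \<Delta>) ((*) y ` quad_order \<Delta>) = (*) (x * y) ` quad_order \<Delta>"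
proof
  show "ideal_mult ((*) x ` quad_order \<Delta>) ((*) y ` quad_order \<Delta>) \<subseteq> (*) (x * y) ` quad_order \<Delta>"
  proof
    fix z assume "z \<in> ideal_mult ((*) x ` quad_order \<Delta>) ((*) y ` quad_order \<Delta>)"
    then show "z \<in> (*) (x * y) ` quad_order \<Delta>"
    proof (induction rule: ideal_mult_induct)
      case zero
      show ?case by (rule image_eqI[of _ _ 0]) (simp_all add: quad_order_0)
    next
      case (add a b z)
      then obtain r s t where "a = x * r" "b = y * s" "z = x * y * t"
        and rst: "r \<in> quad_order \<Delta>" "s \<in> quad_order \<Delta>" "t \<in> quad_order \<Delta>" by blast
      then have "a * b + z = x * y * (r * s + t)" by (simp add: algebra_simps)
      then show ?case using rst quad_order_add quad_order_mult by blast
    qed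
  qed
  show "(*) (x * y) ` quad_order \<Delta> \<subseteq> ideal_mult ((*) x ` quad_order \<Delta>) ((*) y ` quad_order \<Delta>)"
  proof clarify
    fix r assume "r \<in> quad_order \<Delta>"
    then have "(x * r) * (y * 1) \<in> ideal_mult ((*) x ` quad_order \<Delta>) ((*) y ` quad_order \<Delta>)"
      using quad_order_1 by (intro ideal_mult_prod) blast+
    then show "x * y * r \<in> ideal_mult ((*) x ` quad_order \<Delta>) ((*) y ` quad_order \<Delta>)"
      by (simp add: algebra_simps)
  qed
qed

lemma quad_field_denom:
  assumes "x \<in> quad_field \<Delta>"
  shows "\<exists>d\<in>quad_order \<Delta>. d \<noteq> 0 \<and> d * x \<in> quad_order \<Delta>"
proof -
  obtain a b where x: "x = of_rat a + of_rat b * csqrt (of_int \<Delta>)"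
    using assms unfolding quad_field_def by blast
  obtain p q where a: "a = of_int p / of_int q" "q \<noteq> 0"
    by (metis Fract_of_int_quotient Rat_cases less_irrefl)
  obtain r s where b: "b = of_int r / of_int s" "s \<noteq> 0"
    by (metis Fract_of_int_quotient Rat_cases less_irrefl)
  have sq: "csqrt (of_int \<Delta>) = of_int 2 * quad_gen \<Delta> + of_int (- \<Delta>)"
    by (simp add: quad_gen_def field_simps)
  have "of_int (q * s) * x = of_int (p * s) + of_int (r * q) * csqrt (of_int \<Delta>)"
    using a(2) b(2) by (simp add: x a(1) b(1) of_rat_divide field_simps)
  also have "\<dots> \<in> quad_order \<Delta>"
    unfolding sq by (intro quad_order_add quad_order_mult quad_order_int quad_gen_in_order)
  finally show ?thesis
    using a b quad_order_int[of "q * s" \<Delta>] by (intro bexI[of _ "of_int (q * s)"]) auto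
qed

lemma fractional_ideal_principal:
  assumes x: "x \<in> quad_field \<Delta>" "x \<noteq> 0"
  shows "fractional_ideal \<Delta> ((*) x ` quad_order \<Delta>)"
  unfolding fractional_ideal_def
proof (intro conjI ballI)
  let ?I = "(*) x ` quad_order \<Delta>"
  show "?I \<subseteq> quad_field \<Delta>"
    using x quad_order_subset_field by (auto intro: quad_field_mult)
  show "0 \<in> ?I" by (rule image_eqI[of _ _ 0]) (simp_all add: quad_order_0)
  have "x * 1 \<in> ?I" using quad_order_1 by blast
  with x show "?I \<noteq> {0}" by auto
  show "y + z \<in> ?I" if "y \<in> ?I" "z \<in> ?I" for y z
    using that by (auto simp: quad_order_add simp flip: distrib_left)
  show "r * y \<in> ?I" if "r \<in> quad_order \<Delta>" "y \<in> ?I" for r y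
    using that by (auto simp: quad_order_mult mult.left_commute)
  obtain d where d: "d \<in> quad_order \<Delta>" "d \<noteq> 0" "d * x \<in> quad_order \<Delta>"
    using quad_field_denom[OF x(1)] by blast
  then show "\<exists>d\<in>quad_order \<Delta>. d \<noteq> 0 \<and> (\<forall>y\<in>?I. d * y \<in> quad_order \<Delta>)"
    by (intro bexI[of _ d]) (auto simp: quad_order_mult simp flip: mult.assoc)
qed

lemma subgroup_principal_ideals:
  "subgroup (principal_ideals \<Delta>) (invertible_ideal_group \<Delta>)"
proof -
  let ?G = "invertible_ideal_group \<Delta>" and ?O = "quad_order \<Delta>"
  interpret comm_group ?G by (rule comm_group_invertible_ideals)
  have inv_mult: "ideal_mult ((*) x ` ?O) ((*) (inverse x) ` ?O) = ?O" if "x \<noteq> 0" for x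
    using that by (simp add: ideal_mult_principal)
  have carrier: "(*) x ` ?O \<in> carrier ?G" if "x \<in> quad_field \<Delta>" "x \<noteq> 0" for x
    using that fractional_ideal_principal[of x \<Delta>] fractional_ideal_principal[of "inverse x" \<Delta>]
      inv_mult[of x] by (auto simp: invertible_ideal_group_def quad_field_inverse)
  show ?thesis
  proof (rule subgroupI)
    show "principal_ideals \<Delta> \<subseteq> carrier ?G"
      unfolding principal_ideals_def using carrier by blast
    show "principal_ideals \<Delta> \<noteq> {}"
      using quad_field_Rat[of 1 \<Delta>] unfolding principal_ideals_def by auto
    show "inv\<^bsub>?G\<^esub> I \<in> principal_ideals \<Delta>" if I: "I \<in> principal_ideals \<Delta>" for I
    proof -
      obtain x where x: "I = (*) x ` ?O" "x \<in> quad_field \<Delta>" "x \<noteq> 0"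
        using I unfolding principal_ideals_def by blast
      have "inv\<^bsub>?G\<^esub> I = (*) (inverse x) ` ?O"
      proof (rule inv_equality)
        show "I \<in> carrier ?G" "(*) (inverse x) ` ?O \<in> carrier ?G"
          using x carrier quad_field_inverse by simp_all
        show "(*) (inverse x) ` ?O \<otimes>\<^bsub>?G\<^esub> I = \<one>\<^bsub>?G\<^esub>"
          using x by (simp add: invertible_ideal_group_def ideal_mult_principal)
      qed
      then show ?thesis
        using x unfolding principal_ideals_def
        by (auto intro!: exI[of _ "inverse x"] quad_field_inverse)
    qed
    show "I \<otimes>\<^bsub>?G\<^esub> J \<in> principal_ideals \<Delta>"
      if IJ: "I \<in> principal_ideals \<Delta>" "J \<in> principal_ideals \<Delta>" for I J
    proof -
      obtain x where x: "I = (*) x ` ?O" "x \<in> quad_field \<Delta>" "x \<noteq> 0"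
        using IJ(1) unfolding principal_ideals_def by blast
      obtain y where y: "J = (*) y ` ?O" "y \<in> quad_field \<Delta>" "y \<noteq> 0"
        using IJ(2) unfolding principal_ideals_def by blast
      from x y have "I \<otimes>\<^bsub>?G\<^esub> J = (*) (x * y) ` ?O" "x * y \<in> quad_field \<Delta>" "x * y \<noteq> 0"
        by (auto simp: invertible_ideal_group_def ideal_mult_principal quad_field_mult)
      then show ?thesis unfolding principal_ideals_def by blast
    qed
  qed
qed

lemma comm_group_class_group: "comm_group (class_group \<Delta>)"
  unfolding class_group_def
  by (rule comm_group.abelian_FactGroup[OF comm_group_invertible_ideals subgroup_principal_ideals])

end

theory Submission
  imports Defs "HOL-Algebra.Multiplicative_Group" "HOL-Computational_Algebra.Group_Closure"
begin

text \<open>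
  A binary quadratic form \<open>(a, b, c)\<close> of discriminant \<open>\<Delta> = b\<^sup>2 - 4ac\<close> gives the ideal \<open>\<int>a + \<int>\<theta>\<close> with
  \<open>\<theta> = (b + \<surd>\<Delta>) / 2\<close>. Dividing an ideal by an element of least absolute norm shows that each ideal
  class comes from a form with \<open>\<bar>b\<bar> \<le> a \<le> \<bar>c\<bar>\<close>; then \<open>3a\<^sup>2 \<le> \<bar>\<Delta>\<bar>\<close>, so the class group is finite. For
  \<open>\<Delta> = 32\<close> there are only \<open>(1, 0, -8)\<close> and the imprimitive form \<open>(2, 0, -4)\<close>, whose ideal is not
  invertible.

  If \<open>a\<close> divides \<open>b\<close> and is coprime to \<open>c\<close>, the ideal has square \<open>(a)\<close>; if the ideal is principal, the
  form represents \<open>1\<close> or \<open>-1\<close>. For \<open>\<Delta> = 4(m\<^sup>2 - 1)\<close> and the form \<open>(a, a, c)\<close>, multiplying such a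
  representation by \<open>a\<close> yields \<open>x\<^sup>2 - (m\<^sup>2 - 1) y\<^sup>2 = \<plusminus>a\<close>. By descent along the unit \<open>m + \<surd>(m\<^sup>2 - 1)\<close>, any
  value of \<open>x\<^sup>2 - (m\<^sup>2 - 1) y\<^sup>2\<close> below \<open>2(m - 1)\<close> in absolute value is a square \<open>r\<^sup>2\<close> with \<open>r\<close> dividing \<open>x\<close>
  and \<open>y\<close>; so if \<open>1 < a < 2(m - 1)\<close>, then \<open>a = r\<^sup>2\<close> divides \<open>y\<^sup>2\<close> and hence \<open>\<plusminus>1\<close>, a contradiction. Thus the
  form represents a class of order \<open>2\<close>: take \<open>a = 2\<close> if \<open>m\<close> is even and \<open>a = 4\<close> if \<open>m\<close> is odd. For odd
  \<open>m\<close> the order is not maximal, since \<open>\<Delta> / 4\<close> is itself a discriminant.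
\<close>

lemma int_subgroup_Gcd:
  fixes A :: "int set"
  assumes "0 \<in> A" and "\<And>x y. x \<in> A \<Longrightarrow> y \<in> A \<Longrightarrow> x - y \<in> A"
  shows "Gcd A \<in> A"
proof -
  have "x \<in> A" if "x \<in> group_closure A" for x
    using that by induction (use assms in auto)
  then have "group_closure A = A"
    by (auto intro: group_closure.base)
  then show ?thesis
    using Gcd_group_closure_in_group_closure[of A] by simp
qed

lemma (in group) even_order_if_involution:
  assumes "finite (carrier G)" and x: "x \<in> carrier G" "x \<noteq> \<one>" "x \<otimes> x = \<one>"
  shows "even (Coset.order G)"
proof -
  have "x [^] (2::nat) = \<one>"
    using x by (simp add: numeral_2_eq_2)
  then have "ord x dvd 2"
    using pow_eq_id[OF x(1)] by blast
  moreover have "ord x \<noteq> 1"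
    using ord_eq_1[OF x(1)] x(2) by blast
  ultimately have "ord x = 2"
    by (metis prime_nat_iff two_is_prime_nat)
  then show ?thesis
    using ord_dvd_group_order[OF x(1)] by simp
qed

lemma small_pell_bounds:
  fixes m u v :: int
  assumes small: "\<bar>u\<^sup>2 - (m\<^sup>2 - 1) * v\<^sup>2\<bar> < 2 * (m - 1)" and "u \<ge> 0" "v > 0"
  shows "(m - 1) * v < u" and "u < (m + 1) * v"
proof -
  define N where "N = u\<^sup>2 - (m\<^sup>2 - 1) * v\<^sup>2"
  have u2: "u\<^sup>2 = (m\<^sup>2 - 1) * v\<^sup>2 + N"
    by (simp add: N_def)
  have "m > 1"
    using le_less_trans[OF abs_ge_zero small] by simp
  have "1 \<le> v\<^sup>2"
    using \<open>v > 0\<close> by simp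
  then have N_bound: "\<bar>N\<bar> < 2 * (m - 1) * v\<^sup>2"
    using small \<open>m > 1\<close> mult_left_mono[of 1 "v\<^sup>2" "2 * (m - 1)"] unfolding N_def by linarith
  have "u\<^sup>2 - ((m - 1) * v)\<^sup>2 = 2 * (m - 1) * v\<^sup>2 + N"
    unfolding u2 by (simp add: power2_eq_square algebra_simps)
  then have "((m - 1) * v)\<^sup>2 < u\<^sup>2"
    using N_bound by linarith
  then show "(m - 1) * v < u"
    using \<open>u \<ge> 0\<close> by (rule power2_less_imp_less)
  have "((m + 1) * v)\<^sup>2 - u\<^sup>2 = 2 * (m - 1) * v\<^sup>2 + 4 * v\<^sup>2 - N"
    unfolding u2 by (simp add: power2_eq_square algebra_simps)
  then have "u\<^sup>2 < ((m + 1) * v)\<^sup>2"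
    using N_bound zero_le_power2[of v] by linarith
  then show "u < (m + 1) * v"
    by (rule power2_less_imp_less) (use \<open>v > 0\<close> \<open>m > 1\<close> in simp)
qed

text \<open>Descent: multiplying a solution by the unit \<open>m - \<surd>(m\<^sup>2 - 1)\<close> of norm \<open>1\<close> shrinks \<open>\<bar>y\<bar>\<close>
  until \<open>y = 0\<close>.\<close>

lemma small_pell_value_square:
  fixes m x y :: int
  assumes "\<bar>x\<^sup>2 - (m\<^sup>2 - 1) * y\<^sup>2\<bar> < 2 * (m - 1)"
  shows "\<exists>r. x\<^sup>2 - (m\<^sup>2 - 1) * y\<^sup>2 = r\<^sup>2 \<and> r dvd x \<and> r dvd y"
  using assms
proof (induction "nat \<bar>y\<bar>" arbitrary: x y rule: less_induct)
  case less
  show ?case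
  proof (cases "y = 0")
    case True
    then show ?thesis by auto
  next
    case False
    define u v where "u = \<bar>x\<bar>" and "v = \<bar>y\<bar>"
    define u' v' where "u' = m * u - (m\<^sup>2 - 1) * v" and "v' = m * v - u"
    have "(m - 1) * v < u" "u < (m + 1) * v"
      using small_pell_bounds[of u m v] less.prems False by (simp_all add: u_def v_def)
    then have "\<bar>v'\<bar> < v"
      by (simp add: v'_def algebra_simps)
    then have "nat \<bar>v'\<bar> < nat \<bar>y\<bar>"
      by (simp add: v_def)
    moreover have value_eq: "u'\<^sup>2 - (m\<^sup>2 - 1) * v'\<^sup>2 = x\<^sup>2 - (m\<^sup>2 - 1) * y\<^sup>2"
    proof -
      have "u'\<^sup>2 - (m\<^sup>2 - 1) * v'\<^sup>2 = u\<^sup>2 - (m\<^sup>2 - 1) * v\<^sup>2"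
        by (simp add: u'_def v'_def power2_eq_square algebra_simps)
      then show ?thesis by (simp add: u_def v_def)
    qed
    ultimately obtain r where r: "x\<^sup>2 - (m\<^sup>2 - 1) * y\<^sup>2 = r\<^sup>2" "r dvd u'" "r dvd v'"
      using less.hyps[of v' u'] less.prems by auto
    have "u = m * u' + (m\<^sup>2 - 1) * v'" "v = u' + m * v'"
      by (simp_all add: u'_def v'_def power2_eq_square algebra_simps)
    then have "r dvd u" "r dvd v"
      using r(2,3) by simp_all
    then show ?thesis
      using r(1) by (auto simp: u_def v_def)
  qed
qed

section \<open>Coordinates and norms\<close>

definition int_span :: "complex \<Rightarrow> complex \<Rightarrow> complex set" where
  "int_span x y = {of_int p * x + of_int q * y | p q. True}"

lemma int_span_memI: "of_int p * x + of_int q * y \<in> int_span x y"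
  unfolding int_span_def by blast

lemma int_span_memE:
  assumes "z \<in> int_span x y"
  obtains p q where "z = of_int p * x + of_int q * y"
  using assms unfolding int_span_def by blast

lemma int_span_add_multiple: "int_span x (y + of_int k * x) = int_span x y"
proof
  have subset: "int_span x (y + of_int k * x) \<subseteq> int_span x y" for y k
  proof
    fix z assume "z \<in> int_span x (y + of_int k * x)"
    then obtain p q where "z = of_int p * x + of_int q * (y + of_int k * x)"
      by (rule int_span_memE)
    then have "z = of_int (p + q * k) * x + of_int q * y"
      by (simp add: algebra_simps)
    then show "z \<in> int_span x y" by (simp only: int_span_memI)
  qed
  show "int_span x (y + of_int k * x) \<subseteq> int_span x y"
    by (rule subset)
  show "int_span x y \<subseteq> int_span x (y + of_int k * x)"
    using subset[of "y + of_int k * x" "- k"] by simp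
qed

lemma int_span_scale: "(*) c ` int_span x y = int_span (c * x) (c * y)"
proof -
  have "c * (of_int p * x + of_int q * y) = of_int p * (c * x) + of_int q * (c * y)" for p q
    by (simp add: algebra_simps)
  then show ?thesis
    unfolding int_span_def by (force simp: image_iff)
qed

definition quad_surd :: "int \<Rightarrow> int \<Rightarrow> complex" where
  "quad_surd \<Delta> b = (of_int b + csqrt (of_int \<Delta>)) / 2"

lemma quad_gen_eq_quad_surd: "quad_gen \<Delta> = quad_surd \<Delta> \<Delta>"
  by (simp add: quad_gen_def quad_surd_def)

lemma quad_surd_shift: "quad_surd \<Delta> (b + 2 * k) = quad_surd \<Delta> b + of_int k"
  by (simp add: quad_surd_def field_simps)

lemma quad_surd_coords:
  "of_int p + of_int q * quad_surd \<Delta> b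
     = of_rat (of_int (2 * p + q * b) / 2) + of_rat (of_int q / 2) * csqrt (of_int \<Delta>)"
  by (simp add: quad_surd_def of_rat_divide of_rat_add of_rat_mult field_simps)

lemma quad_fieldE:
  assumes "z \<in> quad_field \<Delta>"
  obtains a b where "z = of_rat a + of_rat b * csqrt (of_int \<Delta>)"
  using assms unfolding quad_field_def by blast

lemma of_int_in_quad_field: "of_int k \<in> quad_field \<Delta>"
  using quad_field_Rat[of "of_int k"] by simp

locale quad_disc =
  fixes \<Delta> :: int
  assumes discriminant: "quad_discriminant \<Delta>"
begin

lemma csqrt_irrational: "csqrt (of_int \<Delta>) \<notin> \<rat>"
proof
  assume "csqrt (of_int \<Delta>) \<in> \<rat>"
  then have "csqrt (of_int \<Delta>) \<in> \<int>"
    by (intro rational_algebraic_int_is_int algebraic_int_csqrt algebraic_int_of_int)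
  then obtain k where "csqrt (of_int \<Delta>) = of_int k"
    by (rule Ints_cases)
  then have "(of_int \<Delta> :: complex) = of_int (k\<^sup>2)"
    by (metis of_int_power power2_csqrt)
  then have "\<Delta> = k\<^sup>2"
    by (simp only: of_int_eq_iff)
  then show False
    using discriminant by (auto simp: quad_discriminant_def)
qed

lemma quad_coords_eq_iff:
  "of_rat a + of_rat b * csqrt (of_int \<Delta>) = of_rat c + of_rat d * csqrt (of_int \<Delta>)
     \<longleftrightarrow> a = c \<and> b = d"
proof
  assume eq: "of_rat a + of_rat b * csqrt (of_int \<Delta>) = of_rat c + of_rat d * csqrt (of_int \<Delta>)"
  have "b = d"
  proof (rule ccontr)
    assume "b \<noteq> d"
    have "of_rat (b - d) * csqrt (of_int \<Delta>) = (of_rat (c - a) :: complex)"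
      using eq by (simp add: of_rat_diff algebra_simps)
    then have "csqrt (of_int \<Delta>) = of_rat ((c - a) / (b - d))"
      using \<open>b \<noteq> d\<close> by (simp add: of_rat_divide eq_divide_eq mult.commute)
    then show False
      using csqrt_irrational by simp
  qed
  with eq show "a = c \<and> b = d" by simp
qed simp

lemma quad_surd_coords_eq_iff:
  "of_int p + of_int q * quad_surd \<Delta> b = of_int p' + of_int q' * quad_surd \<Delta> b
     \<longleftrightarrow> p = p' \<and> q = q'"
  unfolding quad_surd_coords quad_coords_eq_iff by auto

end

definition quad_norm :: "int \<Rightarrow> complex \<Rightarrow> rat" where
  "quad_norm \<Delta> z =
     (THE q. \<exists>a b. z = of_rat a + of_rat b * csqrt (of_int \<Delta>) \<and> q = a\<^sup>2 - of_int \<Delta> * b\<^sup>2)"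

context quad_disc
begin

lemma quad_norm_coords:
  "quad_norm \<Delta> (of_rat a + of_rat b * csqrt (of_int \<Delta>)) = a\<^sup>2 - of_int \<Delta> * b\<^sup>2"
  unfolding quad_norm_def by (rule the_equality) (auto simp: quad_coords_eq_iff)

lemma quad_norm_of_rat: "quad_norm \<Delta> (of_rat r) = r\<^sup>2"
  using quad_norm_coords[of r 0] by simp

lemma quad_norm_of_int: "quad_norm \<Delta> (of_int k) = (of_int k)\<^sup>2"
  using quad_norm_of_rat[of "of_int k"] by simp

lemma quad_norm_mult:
  assumes "x \<in> quad_field \<Delta>" "y \<in> quad_field \<Delta>"
  shows "quad_norm \<Delta> (x * y) = quad_norm \<Delta> x * quad_norm \<Delta> y"
proof -
  let ?s = "csqrt (of_int \<Delta>)"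
  obtain a b c d where x: "x = of_rat a + of_rat b * ?s" and y: "y = of_rat c + of_rat d * ?s"
    using assms by (metis quad_fieldE)
  have "x * y = of_rat a * of_rat c + of_rat b * of_rat d * (?s * ?s)
        + (of_rat a * of_rat d + of_rat b * of_rat c) * ?s"
    by (simp add: x y algebra_simps del: csqrt_sq)
  also have "\<dots> = of_rat (a * c + b * d * of_int \<Delta>) + of_rat (a * d + b * c) * ?s"
    by (simp add: of_rat_add of_rat_mult)
  finally have "quad_norm \<Delta> (x * y) = (a * c + b * d * of_int \<Delta>)\<^sup>2 - of_int \<Delta> * (a * d + b * c)\<^sup>2"
    using quad_norm_coords by metis
  then show ?thesis
    unfolding x y quad_norm_coords by (simp add: power2_eq_square algebra_simps)
qed

lemma quad_norm_nonzero:
  assumes "x \<in> quad_field \<Delta>" "x \<noteq> 0"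
  shows "quad_norm \<Delta> x \<noteq> 0"
proof -
  have "quad_norm \<Delta> x * quad_norm \<Delta> (inverse x) = 1"
    using assms quad_norm_mult[OF assms(1) quad_field_inverse[OF assms(1)]] quad_norm_of_int[of 1]
    by simp
  then show ?thesis by auto
qed

lemma quad_order_eq_int_span:
  assumes "even (b - \<Delta>)"
  shows "quad_order \<Delta> = int_span 1 (quad_surd \<Delta> b)"
proof -
  obtain k where "b = \<Delta> + 2 * k"
    using assms by (metis add.commute diff_add_cancel dvdE)
  then have surd: "quad_surd \<Delta> b = quad_gen \<Delta> + of_int k * 1"
    by (simp add: quad_surd_shift quad_gen_eq_quad_surd)
  show ?thesis
    unfolding surd int_span_add_multiple quad_order_eq[OF discriminant] by (simp add: int_span_def)
qed

end

section \<open>Fractional ideals and their classes\<close>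

lemma fractional_ideal_field: "fractional_ideal \<Delta> I \<Longrightarrow> x \<in> I \<Longrightarrow> x \<in> quad_field \<Delta>"
  and fractional_ideal_add: "fractional_ideal \<Delta> I \<Longrightarrow> x \<in> I \<Longrightarrow> y \<in> I \<Longrightarrow> x + y \<in> I"
  and fractional_ideal_scale:
    "fractional_ideal \<Delta> I \<Longrightarrow> r \<in> quad_order \<Delta> \<Longrightarrow> x \<in> I \<Longrightarrow> r * x \<in> I"
  unfolding fractional_ideal_def by blast+

lemma fractional_ideal_int: "fractional_ideal \<Delta> I \<Longrightarrow> x \<in> I \<Longrightarrow> of_int k * x \<in> I"
  by (rule fractional_ideal_scale[OF _ quad_order_int])

lemma fractional_ideal_diff:
  assumes "fractional_ideal \<Delta> I" "x \<in> I" "y \<in> I"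
  shows "x - y \<in> I"
  using fractional_ideal_add[OF assms(1,2) fractional_ideal_int[OF assms(1,3), of "-1"]] by simp

lemma ideal_mult_principal_left:
  assumes I: "fractional_ideal \<Delta> I"
  shows "ideal_mult ((*) x ` quad_order \<Delta>) I = (*) x ` I"
proof
  show "ideal_mult ((*) x ` quad_order \<Delta>) I \<subseteq> (*) x ` I"
  proof
    fix z assume "z \<in> ideal_mult ((*) x ` quad_order \<Delta>) I"
    then show "z \<in> (*) x ` I"
    proof (induction rule: ideal_mult_induct)
      case zero
      show ?case using I by (intro image_eqI[of _ _ 0]) (simp_all add: fractional_ideal_def)
    next
      case (add u v z)
      then obtain r y where "u = x * r" "z = x * y" and ry: "r \<in> quad_order \<Delta>" "y \<in> I" by blast
      then have "u * v + z = x * (r * v + y)" by (simp add: algebra_simps)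
      moreover have "r * v + y \<in> I"
        using fractional_ideal_add[OF I fractional_ideal_scale[OF I]] ry add by blast
      ultimately show ?case by blast
    qed
  qed
  show "(*) x ` I \<subseteq> ideal_mult ((*) x ` quad_order \<Delta>) I"
  proof clarify
    fix y assume "y \<in> I"
    then have "(x * 1) * y \<in> ideal_mult ((*) x ` quad_order \<Delta>) I"
      using quad_order_1 by (intro ideal_mult_prod) blast+
    then show "x * y \<in> ideal_mult ((*) x ` quad_order \<Delta>) I" by simp
  qed
qed

lemma fractional_ideal_image_mult:
  assumes "fractional_ideal \<Delta> I" "x \<in> quad_field \<Delta>" "x \<noteq> 0"
  shows "fractional_ideal \<Delta> ((*) x ` I)"
  using fractional_ideal_mult[OF fractional_ideal_principal[OF assms(2,3)] assms(1)]
  by (simp add: ideal_mult_principal_left[OF assms(1)])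

lemma invertible_ideal_carrier:
  "I \<in> carrier (invertible_ideal_group \<Delta>) \<longleftrightarrow>
     fractional_ideal \<Delta> I \<and> (\<exists>J. fractional_ideal \<Delta> J \<and> ideal_mult I J = quad_order \<Delta>)"
  by (simp add: invertible_ideal_group_def)

lemma invertible_if_principal_square:
  assumes I: "fractional_ideal \<Delta> I" and sq: "ideal_mult I I = (*) x ` quad_order \<Delta>"
    and x: "x \<in> quad_field \<Delta>" "x \<noteq> 0"
  shows "I \<in> carrier (invertible_ideal_group \<Delta>)"
proof -
  let ?X = "(*) (inverse x) ` quad_order \<Delta>"
  have "fractional_ideal \<Delta> (ideal_mult I ?X)"
    using I x by (intro fractional_ideal_mult fractional_ideal_principal quad_field_inverse) auto
  moreover have "ideal_mult I (ideal_mult I ?X) = quad_order \<Delta>"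
    using x by (simp add: sq ideal_mult_principal flip: ideal_mult_assoc)
  ultimately show ?thesis using I invertible_ideal_carrier by blast
qed

lemma invertible_ideal_multiplier:
  assumes I: "I \<in> carrier (invertible_ideal_group \<Delta>)" and t: "\<And>x. x \<in> I \<Longrightarrow> t * x \<in> I"
  shows "t \<in> quad_order \<Delta>"
proof -
  obtain J where J: "ideal_mult I J = quad_order \<Delta>"
    using I invertible_ideal_carrier by blast
  have "t * z \<in> ideal_mult I J" if "z \<in> ideal_mult I J" for z
    using that
  proof (induction rule: ideal_mult_induct)
    case zero
    then show ?case by (simp add: ideal_mult_0)
  next
    case (add x y z)
    then have "(t * x) * y + t * z \<in> ideal_mult I J"
      using ideal_mult_add[OF ideal_mult_prod[OF t]] by blast
    then show ?case by (simp add: algebra_simps)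
  qed
  then have "t * 1 \<in> quad_order \<Delta>"
    unfolding J using quad_order_1 by blast
  then show ?thesis by simp
qed

definition ideal_class :: "int \<Rightarrow> complex set \<Rightarrow> complex set set" where
  "ideal_class \<Delta> I = principal_ideals \<Delta> #>\<^bsub>invertible_ideal_group \<Delta>\<^esub> I"

lemma class_group_carrier:
  "carrier (class_group \<Delta>) = ideal_class \<Delta> ` carrier (invertible_ideal_group \<Delta>)"
  by (auto simp: ideal_class_def class_group_def FactGroup_def RCOSETS_def)

lemma ideal_class_hom: "ideal_class \<Delta> \<in> hom (invertible_ideal_group \<Delta>) (class_group \<Delta>)"
proof -
  interpret comm_group "invertible_ideal_group \<Delta>" by (rule comm_group_invertible_ideals)
  interpret normal "principal_ideals \<Delta>" "invertible_ideal_group \<Delta>"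
    by (rule subgroup_imp_normal[OF subgroup_principal_ideals])
  show ?thesis
    using r_coset_hom_Mod by (simp add: class_group_def ideal_class_def[abs_def])
qed

lemma ideal_class_eq_one_iff:
  assumes I: "I \<in> carrier (invertible_ideal_group \<Delta>)"
  shows "ideal_class \<Delta> I = \<one>\<^bsub>class_group \<Delta>\<^esub> \<longleftrightarrow> I \<in> principal_ideals \<Delta>"
proof -
  interpret comm_group "invertible_ideal_group \<Delta>" by (rule comm_group_invertible_ideals)
  have "\<one>\<^bsub>class_group \<Delta>\<^esub> = principal_ideals \<Delta>"
    by (simp add: class_group_def FactGroup_def)
  then show ?thesis
    using rcos_self[OF I subgroup_principal_ideals] coset_join2[OF I subgroup_principal_ideals]
    by (auto simp: ideal_class_def)
qed

lemma ideal_class_image_mult: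
  assumes I: "I \<in> carrier (invertible_ideal_group \<Delta>)" and x: "x \<in> quad_field \<Delta>" "x \<noteq> 0"
  shows "(*) x ` I \<in> carrier (invertible_ideal_group \<Delta>)"
    and "ideal_class \<Delta> ((*) x ` I) = ideal_class \<Delta> I"
proof -
  let ?G = "invertible_ideal_group \<Delta>" and ?X = "(*) x ` quad_order \<Delta>"
  interpret G: comm_group ?G by (rule comm_group_invertible_ideals)
  interpret C: comm_group "class_group \<Delta>" by (rule comm_group_class_group)
  have "fractional_ideal \<Delta> I"
    using I by (simp add: invertible_ideal_carrier)
  then have mult: "(*) x ` I = ?X \<otimes>\<^bsub>?G\<^esub> I"
    by (simp add: ideal_mult_principal_left invertible_ideal_group_def)
  have principal: "?X \<in> principal_ideals \<Delta>"
    unfolding principal_ideals_def using x by blast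
  then have X: "?X \<in> carrier ?G"
    using subgroup.mem_carrier[OF subgroup_principal_ideals] by blast
  then show "(*) x ` I \<in> carrier ?G"
    unfolding mult using I by simp
  have "ideal_class \<Delta> I \<in> carrier (class_group \<Delta>)"
    unfolding class_group_carrier using I by blast
  then show "ideal_class \<Delta> ((*) x ` I) = ideal_class \<Delta> I"
    using ideal_class_eq_one_iff[OF X] principal unfolding mult hom_mult[OF ideal_class_hom X I] by simp
qed

section \<open>Binary quadratic forms and their ideals\<close>

definition form_ideal :: "int \<Rightarrow> int \<Rightarrow> int \<Rightarrow> complex set" where
  "form_ideal \<Delta> a b = int_span (of_int a) (quad_surd \<Delta> b)"

lemma form_ideal_memI: "of_int p * of_int a + of_int q * quad_surd \<Delta> b \<in> form_ideal \<Delta> a b"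
  unfolding form_ideal_def by (rule int_span_memI)

lemma form_idealE:
  assumes "z \<in> form_ideal \<Delta> a b"
  obtains p q where "z = of_int p * of_int a + of_int q * quad_surd \<Delta> b"
  using assms unfolding form_ideal_def by (rule int_span_memE)

lemma form_ideal_shift: "form_ideal \<Delta> a (b + 2 * a * k) = form_ideal \<Delta> a b"
proof -
  have "quad_surd \<Delta> (b + 2 * a * k) = quad_surd \<Delta> b + of_int k * of_int a"
    using quad_surd_shift[of \<Delta> b "a * k"] by (simp add: mult.assoc mult.commute[of "of_int k"])
  then show ?thesis
    by (simp add: form_ideal_def int_span_add_multiple)
qed

locale quad_form = quad_disc +
  fixes a b c :: int
  assumes form_disc: "b\<^sup>2 - 4 * a * c = \<Delta>"
begin

lemma leading_coeff_nonzero: "a \<noteq> 0"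
  using discriminant form_disc unfolding quad_discriminant_def by auto

lemma middle_coeff_parity: "even (b - \<Delta>)"
  by (simp flip: form_disc)

lemma quad_order_eq: "quad_order \<Delta> = int_span 1 (quad_surd \<Delta> b)"
  by (rule quad_order_eq_int_span[OF middle_coeff_parity])

lemma quad_order_memI: "of_int p + of_int q * quad_surd \<Delta> b \<in> quad_order \<Delta>"
  using int_span_memI[of p 1 q "quad_surd \<Delta> b"] by (simp add: quad_order_eq)

lemma quad_orderE:
  assumes "z \<in> quad_order \<Delta>"
  obtains p q where "z = of_int p + of_int q * quad_surd \<Delta> b"
  using assms unfolding quad_order_eq int_span_def by auto

lemma quad_surd_sq: "quad_surd \<Delta> b * quad_surd \<Delta> b = of_int b * quad_surd \<Delta> b - of_int (a * c)"
proof -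
  let ?s = "csqrt (of_int \<Delta>)"
  have "4 * (quad_surd \<Delta> b * quad_surd \<Delta> b) = of_int b * of_int b + 2 * of_int b * ?s + ?s * ?s"
    by (simp add: quad_surd_def field_simps del: csqrt_sq)
  also have "\<dots> = of_int b * of_int b + 2 * of_int b * ?s + of_int (b\<^sup>2 - 4 * a * c)"
    by (simp add: form_disc)
  also have "\<dots> = 4 * (of_int b * quad_surd \<Delta> b - of_int (a * c))"
    by (simp add: quad_surd_def power2_eq_square field_simps)
  finally show ?thesis by (simp only: mult_cancel_left zero_neq_numeral) simp
qed

lemma quad_surd_mult:
  "(of_int p + of_int q * quad_surd \<Delta> b) * (of_int x * of_int a + of_int y * quad_surd \<Delta> b)
     = of_int (p * x - q * c * y) * of_int a + of_int (p * y + q * (a * x + b * y)) * quad_surd \<Delta> b"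
  (is "?u * ?v = ?w")
proof -
  have "?u * ?v = of_int (p * x) * of_int a + of_int (p * y + q * x * a) * quad_surd \<Delta> b
      + of_int (q * y) * (quad_surd \<Delta> b * quad_surd \<Delta> b)"
    by (simp add: algebra_simps)
  then show ?thesis
    unfolding quad_surd_sq by (simp add: algebra_simps)
qed

lemma form_ideal_subset_order: "form_ideal \<Delta> a b \<subseteq> quad_order \<Delta>"
proof
  fix z assume "z \<in> form_ideal \<Delta> a b"
  then obtain p q where "z = of_int p * of_int a + of_int q * quad_surd \<Delta> b"
    by (rule form_idealE)
  then have "z = of_int (p * a) + of_int q * quad_surd \<Delta> b" by simp
  then show "z \<in> quad_order \<Delta>" by (simp only: quad_order_memI)
qed

lemma fractional_ideal_form_ideal: "fractional_ideal \<Delta> (form_ideal \<Delta> a b)"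
  unfolding fractional_ideal_def
proof (intro conjI ballI)
  let ?I = "form_ideal \<Delta> a b"
  show "?I \<subseteq> quad_field \<Delta>"
    using form_ideal_subset_order quad_order_subset_field by blast
  show "0 \<in> ?I"
    using form_ideal_memI[of 0 a 0 \<Delta> b] by simp
  show "?I \<noteq> {0}"
    using form_ideal_memI[of 1 a 0 \<Delta> b] leading_coeff_nonzero by auto
  show "u + v \<in> ?I" if u: "u \<in> ?I" and v: "v \<in> ?I" for u v
  proof -
    obtain p q where "u = of_int p * of_int a + of_int q * quad_surd \<Delta> b"
      using u by (rule form_idealE)
    moreover obtain p' q' where "v = of_int p' * of_int a + of_int q' * quad_surd \<Delta> b"
      using v by (rule form_idealE)
    ultimately have "u + v = of_int (p + p') * of_int a + of_int (q + q') * quad_surd \<Delta> b"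
      by (simp add: algebra_simps)
    then show ?thesis by (simp only: form_ideal_memI)
  qed
  show "r * u \<in> ?I" if r: "r \<in> quad_order \<Delta>" and u: "u \<in> ?I" for r u
  proof -
    obtain p q where "r = of_int p + of_int q * quad_surd \<Delta> b"
      using r by (rule quad_orderE)
    moreover obtain x y where "u = of_int x * of_int a + of_int y * quad_surd \<Delta> b"
      using u by (rule form_idealE)
    ultimately show ?thesis by (simp only: quad_surd_mult form_ideal_memI)
  qed
  show "\<exists>d\<in>quad_order \<Delta>. d \<noteq> 0 \<and> (\<forall>x\<in>?I. d * x \<in> quad_order \<Delta>)"
    using form_ideal_subset_order quad_order_1 by (intro bexI[of _ 1]) auto
qed

lemma quad_norm_quad_surd:
  "quad_norm \<Delta> (of_int p + of_int q * quad_surd \<Delta> b) = of_int (p\<^sup>2 + b * p * q + a * c * q\<^sup>2)"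
proof -
  have \<Delta>: "(of_int \<Delta> :: rat) = of_int b * of_int b - 4 * of_int a * of_int c"
    by (simp flip: form_disc add: power2_eq_square)
  show ?thesis
    unfolding quad_surd_coords quad_norm_coords \<Delta> by (simp add: power2_eq_square field_simps)
qed

lemma form_ideal_coords_eq_iff:
  "of_int p * of_int a + of_int q * quad_surd \<Delta> b = of_int p' * of_int a + of_int q' * quad_surd \<Delta> b
     \<longleftrightarrow> p = p' \<and> q = q'"
  using quad_surd_coords_eq_iff[of "p * a" q b "p' * a" q'] leading_coeff_nonzero by simp

text \<open>If \<open>\<alpha> = x a + y \<theta>\<close> generates the ideal, the value of the form at \<open>(x, y)\<close> is the determinant
  of the \<open>\<int>\<close>-basis \<open>(\<alpha>, \<alpha> \<theta>)\<close> relative to the basis \<open>(a, \<theta>)\<close>, hence a unit.\<close>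

lemma principal_form_ideal_represents_unit:
  assumes "form_ideal \<Delta> a b \<in> principal_ideals \<Delta>"
  shows "\<exists>x y. \<bar>a * x\<^sup>2 + b * x * y + c * y\<^sup>2\<bar> = 1"
proof -
  let ?\<theta> = "quad_surd \<Delta> b"
  obtain \<alpha> where gen: "form_ideal \<Delta> a b = (*) \<alpha> ` quad_order \<Delta>"
    using assms unfolding principal_ideals_def by blast
  have "\<alpha> * 1 \<in> form_ideal \<Delta> a b"
    unfolding gen using quad_order_1 by blast
  then obtain x y where "\<alpha> * 1 = of_int x * of_int a + of_int y * ?\<theta>"
    by (rule form_idealE)
  then have \<alpha>: "\<alpha> = of_int x * of_int a + of_int y * ?\<theta>" by simp
  have rows_span: "\<exists>p q. p * x - q * c * y = i \<and> p * y + q * (a * x + b * y) = j" for i j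
  proof -
    have "of_int i * of_int a + of_int j * ?\<theta> \<in> form_ideal \<Delta> a b"
      by (rule form_ideal_memI)
    then obtain u where u: "u \<in> quad_order \<Delta>" "of_int i * of_int a + of_int j * ?\<theta> = u * \<alpha>"
      unfolding gen by (auto simp: mult.commute)
    obtain p q where "u = of_int p + of_int q * ?\<theta>"
      using u(1) by (rule quad_orderE)
    with u(2) have "of_int i * of_int a + of_int j * ?\<theta>
        = of_int (p * x - q * c * y) * of_int a + of_int (p * y + q * (a * x + b * y)) * ?\<theta>"
      by (simp only: \<alpha> quad_surd_mult)
    then have "i = p * x - q * c * y" "j = p * y + q * (a * x + b * y)"
      unfolding form_ideal_coords_eq_iff by simp_all
    then show ?thesis by blast
  qed
  obtain p q where pq: "p * x - q * c * y = 1" "p * y + q * (a * x + b * y) = 0"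
    using rows_span by blast
  obtain r s where rs: "r * x - s * c * y = 0" "r * y + s * (a * x + b * y) = 1"
    using rows_span by blast
  have "(a * x\<^sup>2 + b * x * y + c * y\<^sup>2) * (p * s - q * r)
      = (p * x - q * c * y) * (r * y + s * (a * x + b * y))
        - (p * y + q * (a * x + b * y)) * (r * x - s * c * y)"
    by (simp add: power2_eq_square algebra_simps)
  also have "\<dots> = 1"
    unfolding pq rs by simp
  finally have "a * x\<^sup>2 + b * x * y + c * y\<^sup>2 dvd 1"
    by (metis dvd_triv_left)
  then show ?thesis
    using zdvd1_eq by blast
qed

lemma ambiguous_form_ideal_square_subset:
  assumes "a dvd b"
  shows "ideal_mult (form_ideal \<Delta> a b) (form_ideal \<Delta> a b) \<subseteq> (*) (of_int a) ` quad_order \<Delta>"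
proof
  let ?I = "form_ideal \<Delta> a b" and ?\<theta> = "quad_surd \<Delta> b"
  obtain k where b: "b = a * k"
    using assms by blast
  fix z assume "z \<in> ideal_mult ?I ?I"
  then show "z \<in> (*) (of_int a) ` quad_order \<Delta>"
  proof (induction rule: ideal_mult_induct)
    case zero
    show ?case by (rule image_eqI[of _ _ 0]) (simp_all add: quad_order_0)
  next
    case (add u v z)
    obtain x y where u: "u = of_int x * of_int a + of_int y * ?\<theta>"
      using add(1) by (rule form_idealE)
    obtain x' y' where v: "v = of_int x' * of_int a + of_int y' * ?\<theta>"
      using add(2) by (rule form_idealE)
    obtain w where w: "z = of_int a * w" "w \<in> quad_order \<Delta>"
      using add(3) by blast
    define r where
      "r = of_int (a * x * x' - c * y * y') + of_int (x * y' + y * x' + k * y * y') * ?\<theta>"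
    have "r \<in> quad_order \<Delta>"
      unfolding r_def by (rule quad_order_memI)
    moreover have "u * v = of_int a * r"
      using quad_surd_mult[of "x * a" y x' y'] by (simp add: u v r_def b algebra_simps)
    ultimately have "u * v + z = of_int a * (r + w)" "r + w \<in> quad_order \<Delta>"
      using w by (simp_all add: distrib_left quad_order_add)
    then show ?case by blast
  qed
qed

lemma leading_coeff_in_ambiguous_form_ideal_square:
  assumes "a dvd b" "coprime a c"
  shows "of_int a \<in> ideal_mult (form_ideal \<Delta> a b) (form_ideal \<Delta> a b)"
    (is "_ \<in> ?II")
proof -
  let ?\<theta> = "quad_surd \<Delta> b"
  obtain k where b: "b = a * k"
    using assms(1) by blast
  note II = fractional_ideal_mult[OF fractional_ideal_form_ideal fractional_ideal_form_ideal]
  have products: "of_int a * of_int a \<in> ?II" "of_int a * ?\<theta> \<in> ?II" "?\<theta> * ?\<theta> \<in> ?II"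
    using form_ideal_memI[of 1 a 0 \<Delta> b] form_ideal_memI[of 0 a 1 \<Delta> b]
    by (simp_all add: ideal_mult_prod)
  have "of_int k * (of_int a * ?\<theta>) - ?\<theta> * ?\<theta> \<in> ?II"
    by (intro fractional_ideal_diff[OF II] fractional_ideal_int[OF II] products)
  then have ac: "of_int (a * c) \<in> ?II"
    unfolding quad_surd_sq by (simp add: b mult.assoc mult.left_commute)
  obtain u v where "u * a + v * c = 1"
    using assms(2) by (metis bezout_int coprime_imp_gcd_eq_1)
  then have "(of_int a :: complex) = of_int (a * (u * a + v * c))" by simp
  also have "\<dots> = of_int u * (of_int a * of_int a) + of_int v * of_int (a * c)"
    by (simp add: algebra_simps)
  also have "\<dots> \<in> ?II"
    by (intro fractional_ideal_add[OF II] fractional_ideal_int[OF II] products(1) ac)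
  finally show ?thesis .
qed

lemma ambiguous_form_ideal_square:
  assumes "a dvd b" "coprime a c"
  shows "ideal_mult (form_ideal \<Delta> a b) (form_ideal \<Delta> a b) = (*) (of_int a) ` quad_order \<Delta>"
proof
  show "(*) (of_int a) ` quad_order \<Delta> \<subseteq> ideal_mult (form_ideal \<Delta> a b) (form_ideal \<Delta> a b)"
    using fractional_ideal_scale[OF fractional_ideal_mult[OF fractional_ideal_form_ideal
        fractional_ideal_form_ideal] _ leading_coeff_in_ambiguous_form_ideal_square[OF assms]]
    by (auto simp: mult.commute)
qed (rule ambiguous_form_ideal_square_subset[OF assms(1)])

lemma invertible_form_ideal_imp_primitive:
  assumes "form_ideal \<Delta> a b \<in> carrier (invertible_ideal_group \<Delta>)"
  shows "gcd a (gcd b c) = 1"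
proof -
  let ?\<theta> = "quad_surd \<Delta> b"
  define g where "g = gcd a (gcd b c)"
  have "g dvd a" "g dvd b" "g dvd c"
    unfolding g_def by (simp_all add: gcd_dvd1 gcd_dvd2 dvd_trans[OF gcd_dvd2])
  then obtain a' b' c' where abc: "a = g * a'" "b = g * b'" "c = g * c'"
    by (elim dvdE)
  have "g \<noteq> 0"
    unfolding g_def using leading_coeff_nonzero by simp
  have "?\<theta> / of_int g * u \<in> form_ideal \<Delta> a b" if u_mem: "u \<in> form_ideal \<Delta> a b" for u
  proof -
    obtain x y where u: "u = of_int x * of_int a + of_int y * ?\<theta>"
      using u_mem by (rule form_idealE)
    have "?\<theta> * u = of_int (- c * y) * of_int a + of_int (a * x + b * y) * ?\<theta>"
      using quad_surd_mult[of 0 1 x y] by (simp add: u)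
    also have "\<dots> = of_int g * (of_int (- c' * y) * of_int a + of_int (a' * x + b' * y) * ?\<theta>)"
      by (simp add: abc algebra_simps)
    finally have "?\<theta> / of_int g * u = of_int (- c' * y) * of_int a + of_int (a' * x + b' * y) * ?\<theta>"
      using \<open>g \<noteq> 0\<close> by (simp add: field_simps)
    then show ?thesis
      by (simp only: form_ideal_memI)
  qed
  then have "?\<theta> / of_int g \<in> quad_order \<Delta>"
    by (rule invertible_ideal_multiplier[OF assms])
  then obtain p q where "?\<theta> / of_int g = of_int p + of_int q * ?\<theta>"
    by (rule quad_orderE)
  then have "of_int 0 + of_int 1 * ?\<theta> = of_int (g * p) + of_int (g * q) * ?\<theta>"
    using \<open>g \<noteq> 0\<close> by (simp add: field_simps)
  then have "1 = g * q"
    unfolding quad_surd_coords_eq_iff by simp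
  then have "g dvd 1" ..
  then show ?thesis
    unfolding g_def by simp
qed

lemma even_class_number_if_ambiguous:
  assumes fin: "finite (carrier (class_group \<Delta>))"
    and "a dvd b" "coprime a c" "form_ideal \<Delta> a b \<notin> principal_ideals \<Delta>"
  shows "even (class_number \<Delta>)"
proof -
  let ?G = "invertible_ideal_group \<Delta>" and ?I = "form_ideal \<Delta> a b"
  interpret G: comm_group ?G by (rule comm_group_invertible_ideals)
  interpret C: comm_group "class_group \<Delta>" by (rule comm_group_class_group)
  have sq: "ideal_mult ?I ?I = (*) (of_int a) ` quad_order \<Delta>"
    by (rule ambiguous_form_ideal_square[OF assms(2,3)])
  have I: "?I \<in> carrier ?G"
    using invertible_if_principal_square[OF fractional_ideal_form_ideal sq] leading_coeff_nonzero
    by (simp add: of_int_in_quad_field)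
  have "?I \<otimes>\<^bsub>?G\<^esub> ?I \<in> principal_ideals \<Delta>"
    using leading_coeff_nonzero of_int_in_quad_field[of a \<Delta>]
    by (auto simp: invertible_ideal_group_def sq principal_ideals_def)
  then have "ideal_class \<Delta> ?I \<otimes>\<^bsub>class_group \<Delta>\<^esub> ideal_class \<Delta> ?I = \<one>\<^bsub>class_group \<Delta>\<^esub>"
    using hom_mult[OF ideal_class_hom I I] ideal_class_eq_one_iff[OF G.m_closed[OF I I]] by simp
  moreover have "ideal_class \<Delta> ?I \<noteq> \<one>\<^bsub>class_group \<Delta>\<^esub>"
    using assms(4) I by (simp add: ideal_class_eq_one_iff)
  moreover have "ideal_class \<Delta> ?I \<in> carrier (class_group \<Delta>)"
    using I by (simp add: class_group_carrier)
  ultimately show ?thesis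
    using C.even_order_if_involution[OF fin] by (simp add: class_number_def)
qed

end

section \<open>Reduction of ideal classes\<close>

context quad_disc
begin

lemma principal_form:
  obtains b c where "quad_form \<Delta> 1 b c"
proof (cases "\<Delta> mod 4 = 0")
  case True
  then have "quad_form \<Delta> 1 0 (- (\<Delta> div 4))"
    by unfold_locales auto
  then show thesis by (rule that)
next
  case False
  then have "\<Delta> mod 4 = 1"
    using discriminant by (simp add: quad_discriminant_def)
  then have "1 + 4 * (\<Delta> div 4) = \<Delta>"
    using mod_mult_div_eq[of \<Delta> 4] by simp
  then have "quad_form \<Delta> 1 1 (- (\<Delta> div 4))"
    by unfold_locales simp
  then show thesis by (rule that)
qed

lemma quad_norm_Ints:
  assumes "z \<in> quad_order \<Delta>"
  shows "quad_norm \<Delta> z \<in> \<int>"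
proof -
  obtain b c where "quad_form \<Delta> 1 b c" by (rule principal_form)
  then interpret quad_form \<Delta> 1 b c .
  obtain p q where "z = of_int p + of_int q * quad_surd \<Delta> b"
    using assms by (rule quad_orderE)
  then show ?thesis by (simp only: quad_norm_quad_surd Ints_of_int)
qed

lemma quad_norm_multiple:
  assumes "z \<in> quad_order \<Delta>"
  shows "\<exists>w\<in>quad_order \<Delta>. of_rat (quad_norm \<Delta> z) = w * z"
proof -
  obtain b c where "quad_form \<Delta> 1 b c" by (rule principal_form)
  then interpret quad_form \<Delta> 1 b c .
  let ?\<theta> = "quad_surd \<Delta> b"
  obtain p q where z: "z = of_int p + of_int q * ?\<theta>"
    using assms by (rule quad_orderE)
  define w where "w = of_int (p + q * b) + of_int (- q) * ?\<theta>"
  have "w * z = of_int (p\<^sup>2 + b * p * q + c * q\<^sup>2)"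
    using quad_surd_mult[of "p + q * b" "- q" p q]
    by (simp add: z w_def power2_eq_square algebra_simps)
  moreover have "quad_norm \<Delta> z = of_int (p\<^sup>2 + b * p * q + c * q\<^sup>2)"
    unfolding z quad_norm_quad_surd by simp
  ultimately have "of_rat (quad_norm \<Delta> z) = w * z"
    by (simp only: of_rat_of_int_eq)
  moreover have "w \<in> quad_order \<Delta>"
    unfolding w_def by (rule quad_order_memI)
  ultimately show ?thesis by blast
qed

lemma fractional_ideal_int_denom:
  assumes I: "fractional_ideal \<Delta> I"
  obtains m :: int where "m > 0" "\<And>x. x \<in> I \<Longrightarrow> of_int m * x \<in> quad_order \<Delta>"
proof -
  obtain d where d: "d \<in> quad_order \<Delta>" "d \<noteq> 0" "\<forall>x\<in>I. d * x \<in> quad_order \<Delta>"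
    using I unfolding fractional_ideal_def by meson
  obtain k where k: "quad_norm \<Delta> d = of_int k"
    using quad_norm_Ints[OF d(1)] by (rule Ints_cases)
  have "d \<in> quad_field \<Delta>"
    using d(1) quad_order_subset_field by blast
  then have "k \<noteq> 0"
    using quad_norm_nonzero[OF _ d(2)] k by simp
  obtain w where w: "w \<in> quad_order \<Delta>" "of_int k = w * d"
    using quad_norm_multiple[OF d(1)] k by auto
  have "of_int \<bar>k\<bar> * x \<in> quad_order \<Delta>" if "x \<in> I" for x
  proof -
    have "of_int (sgn k) * (w * (d * x)) \<in> quad_order \<Delta>"
      using d(3) that by (intro quad_order_mult[OF quad_order_int] quad_order_mult[OF w(1)]) blast
    also have "of_int (sgn k) * (w * (d * x)) = of_int (k * sgn k) * x"
      by (simp add: w(2))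
    finally show ?thesis by (simp only: abs_sgn)
  qed
  with \<open>k \<noteq> 0\<close> show thesis
    by (intro that[of "\<bar>k\<bar>"]) auto
qed

lemma fractional_ideal_least_norm:
  assumes I: "fractional_ideal \<Delta> I"
  obtains \<alpha> where "\<alpha> \<in> I" "\<alpha> \<noteq> 0"
    "\<And>z. z \<in> I \<Longrightarrow> z \<noteq> 0 \<Longrightarrow> \<bar>quad_norm \<Delta> \<alpha>\<bar> \<le> \<bar>quad_norm \<Delta> z\<bar>"
proof -
  obtain m where m: "m > 0" "\<And>x. x \<in> I \<Longrightarrow> of_int m * x \<in> quad_order \<Delta>"
    using fractional_ideal_int_denom[OF I] by blast
  define f where "f z = nat \<bar>\<lfloor>(of_int m)\<^sup>2 * quad_norm \<Delta> z\<rfloor>\<bar>" for z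
  have f: "(of_int m)\<^sup>2 * \<bar>quad_norm \<Delta> z\<bar> = of_nat (f z)" if z: "z \<in> I" for z
  proof -
    have "quad_norm \<Delta> (of_int m * z) = (of_int m)\<^sup>2 * quad_norm \<Delta> z"
      using quad_norm_mult[OF of_int_in_quad_field fractional_ideal_field[OF I z]]
      by (simp add: quad_norm_of_int)
    moreover obtain k where "quad_norm \<Delta> (of_int m * z) = of_int k"
      using quad_norm_Ints[OF m(2)[OF z]] by (rule Ints_cases)
    ultimately have k: "(of_int m)\<^sup>2 * quad_norm \<Delta> z = of_int k" by simp
    have "(of_int m)\<^sup>2 * \<bar>quad_norm \<Delta> z\<bar> = \<bar>(of_int m)\<^sup>2 * quad_norm \<Delta> z\<bar>"
      by (simp add: abs_mult)
    then show ?thesis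
      by (simp add: f_def k)
  qed
  have "\<exists>x\<in>I. x \<noteq> 0"
    using I unfolding fractional_ideal_def by blast
  then obtain \<alpha> where \<alpha>: "\<alpha> \<in> I \<and> \<alpha> \<noteq> 0" "\<forall>z. z \<in> I \<and> z \<noteq> 0 \<longrightarrow> f \<alpha> \<le> f z"
    using ex_has_least_nat[of "\<lambda>z. z \<in> I \<and> z \<noteq> 0" _ f] by blast
  have "\<bar>quad_norm \<Delta> \<alpha>\<bar> \<le> \<bar>quad_norm \<Delta> z\<bar>" if "z \<in> I" "z \<noteq> 0" for z
  proof -
    have "(of_int m)\<^sup>2 * \<bar>quad_norm \<Delta> \<alpha>\<bar> \<le> (of_int m)\<^sup>2 * \<bar>quad_norm \<Delta> z\<bar>"
      using f \<alpha> that by simp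
    then show ?thesis
      using m(1) by simp
  qed
  with \<alpha> that show thesis by blast
qed

end

lemma Ints_if_int_multiple:
  fixes x :: "'a :: field_char_0"
  assumes "J \<inter> \<rat> = \<int>" and "x \<in> J" "of_int n * x = of_int k" "n > 0"
  shows "x \<in> \<int>"
proof -
  have "x = of_int k / of_int n"
    using assms(3,4) by (simp add: eq_divide_eq mult.commute)
  then have "x \<in> \<rat>" by simp
  with assms(1,2) show ?thesis by blast
qed

definition surd_coords :: "int \<Rightarrow> int \<Rightarrow> complex set \<Rightarrow> int set" where
  "surd_coords \<Delta> m J = {q. \<exists>z\<in>J. \<exists>p. of_int m * z = of_int p + of_int q * quad_gen \<Delta>}"

lemma Gcd_surd_coords:
  assumes J: "fractional_ideal \<Delta> J"
  shows "Gcd (surd_coords \<Delta> m J) \<in> surd_coords \<Delta> m J"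
proof (rule int_subgroup_Gcd)
  have "0 \<in> J"
    using J by (simp add: fractional_ideal_def)
  then show "0 \<in> surd_coords \<Delta> m J"
    unfolding surd_coords_def by (intro CollectI bexI[of _ 0] exI[of _ 0]) simp_all
  fix q q' assume q: "q \<in> surd_coords \<Delta> m J" and q': "q' \<in> surd_coords \<Delta> m J"
  obtain z p where z: "z \<in> J" "of_int m * z = of_int p + of_int q * quad_gen \<Delta>"
    using q unfolding surd_coords_def by blast
  obtain z' p' where z': "z' \<in> J" "of_int m * z' = of_int p' + of_int q' * quad_gen \<Delta>"
    using q' unfolding surd_coords_def by blast
  have "of_int m * (z - z') = of_int (p - p') + of_int (q - q') * quad_gen \<Delta>"
    using z(2) z'(2) by (simp add: algebra_simps)
  then show "q - q' \<in> surd_coords \<Delta> m J"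
    unfolding surd_coords_def using fractional_ideal_diff[OF J z(1) z'(1)] by blast
qed

definition normalized_ideal :: "int \<Rightarrow> complex set \<Rightarrow> bool" where
  "normalized_ideal \<Delta> J \<longleftrightarrow>
     fractional_ideal \<Delta> J \<and> 1 \<in> J \<and> (\<forall>z\<in>J. z \<noteq> 0 \<longrightarrow> 1 \<le> \<bar>quad_norm \<Delta> z\<bar>)"

context quad_disc
begin

lemma ex_normalized_multiple:
  assumes I: "fractional_ideal \<Delta> I"
  obtains x where "x \<in> quad_field \<Delta>" "x \<noteq> 0" "normalized_ideal \<Delta> ((*) x ` I)"
proof -
  obtain \<alpha> where \<alpha>: "\<alpha> \<in> I" "\<alpha> \<noteq> 0"
    and least: "\<And>z. z \<in> I \<Longrightarrow> z \<noteq> 0 \<Longrightarrow> \<bar>quad_norm \<Delta> \<alpha>\<bar> \<le> \<bar>quad_norm \<Delta> z\<bar>"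
    using fractional_ideal_least_norm[OF I] by blast
  let ?J = "(*) (inverse \<alpha>) ` I"
  have \<alpha>_field: "\<alpha> \<in> quad_field \<Delta>"
    using fractional_ideal_field[OF I \<alpha>(1)] .
  have J: "fractional_ideal \<Delta> ?J"
    using I \<alpha>_field \<alpha>(2) by (simp add: fractional_ideal_image_mult quad_field_inverse)
  have "inverse \<alpha> * \<alpha> \<in> ?J"
    using \<alpha>(1) by blast
  then have "1 \<in> ?J"
    using \<alpha>(2) by simp
  moreover have "1 \<le> \<bar>quad_norm \<Delta> z\<bar>" if z: "z \<in> ?J" "z \<noteq> 0" for z
  proof -
    have y: "\<alpha> * z \<in> I" "\<alpha> * z \<noteq> 0"
      using z \<alpha>(2) by (auto simp flip: mult.assoc)
    have "\<bar>quad_norm \<Delta> \<alpha>\<bar> * 1 \<le> \<bar>quad_norm \<Delta> \<alpha>\<bar> * \<bar>quad_norm \<Delta> z\<bar>"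
      using least[OF y] quad_norm_mult[OF \<alpha>_field fractional_ideal_field[OF J z(1)]]
      by (simp add: abs_mult)
    then show ?thesis
      using quad_norm_nonzero[OF \<alpha>_field \<alpha>(2)] by simp
  qed
  ultimately have "normalized_ideal \<Delta> ?J"
    using J by (simp add: normalized_ideal_def)
  then show thesis
    using \<alpha>(2) by (intro that[OF quad_field_inverse[OF \<alpha>_field]]) simp_all
qed

lemma normalized_ideal_Int_Rats:
  assumes J: "normalized_ideal \<Delta> J"
  shows "J \<inter> \<rat> = \<int>"
proof
  have fJ: "fractional_ideal \<Delta> J" and "1 \<in> J"
    using J by (simp_all add: normalized_ideal_def)
  have int: "of_int k \<in> J" for k
    using fractional_ideal_int[OF fJ \<open>1 \<in> J\<close>, of k] by simp
  then show "\<int> \<subseteq> J \<inter> \<rat>"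
    by (auto elim: Ints_cases)
  show "J \<inter> \<rat> \<subseteq> \<int>"
  proof
    fix x assume "x \<in> J \<inter> \<rat>"
    then obtain r where r: "of_rat r \<in> J" "x = of_rat r"
      by (auto elim: Rats_cases)
    have "(of_rat (frac r) :: complex) = of_rat r - of_int \<lfloor>r\<rfloor>"
      by (simp add: frac_def of_rat_diff)
    then have "of_rat (frac r) \<in> J"
      using fractional_ideal_diff[OF fJ r(1) int] by simp
    moreover have "\<bar>quad_norm \<Delta> (of_rat (frac r))\<bar> < 1"
      using power_strict_mono[OF frac_lt_1[of r] frac_ge_0, of 2] by (simp add: quad_norm_of_rat)
    ultimately have "frac r = 0"
      using J unfolding normalized_ideal_def by fastforce
    then show "x \<in> \<int>"
      unfolding r(2) by (auto elim!: Ints_cases)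
  qed
qed

lemma eq_int_span_if_Gcd_surd_coords:
  assumes J: "fractional_ideal \<Delta> J" "J \<inter> \<rat> = \<int>"
    and m: "m > 0" "\<And>x. x \<in> J \<Longrightarrow> of_int m * x \<in> quad_order \<Delta>"
    and \<tau>: "\<tau> \<in> J" "of_int m * \<tau> = of_int p + of_int (Gcd (surd_coords \<Delta> m J)) * quad_gen \<Delta>"
  shows "J = int_span 1 \<tau>"
proof
  have "of_int k \<in> J" for k
    using J(2) Ints_of_int by blast
  then show "int_span 1 \<tau> \<subseteq> J"
    using fractional_ideal_add[OF J(1) _ fractional_ideal_int[OF J(1) \<tau>(1)]]
    by (auto elim!: int_span_memE)
  show "J \<subseteq> int_span 1 \<tau>"
  proof
    fix z assume z: "z \<in> J"
    obtain p' q where mz: "of_int m * z = of_int p' + of_int q * quad_gen \<Delta>"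
      using m(2)[OF z] unfolding quad_order_eq[OF discriminant] by blast
    then have "q \<in> surd_coords \<Delta> m J"
      unfolding surd_coords_def using z by blast
    then obtain k where "q = Gcd (surd_coords \<Delta> m J) * k"
      using Gcd_dvd by blast
    then have "of_int m * (z - of_int k * \<tau>) = of_int (p' - k * p)"
      using mz \<tau>(2) by (simp add: right_diff_distrib mult.left_commute[of "of_int m"]) (simp add: algebra_simps)
    moreover have "z - of_int k * \<tau> \<in> J"
      using fractional_ideal_diff[OF J(1) z fractional_ideal_int[OF J(1) \<tau>(1)]] .
    ultimately have "z - of_int k * \<tau> \<in> \<int>"
      using Ints_if_int_multiple[OF J(2) _ _ m(1)] by blast
    then obtain i where "z - of_int k * \<tau> = of_int i"
      by (rule Ints_cases)
    then have "z = of_int i * 1 + of_int k * \<tau>"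
      by (simp add: algebra_simps)
    then show "z \<in> int_span 1 \<tau>" by (simp only: int_span_memI)
  qed
qed

lemma fractional_ideal_eq_int_span:
  assumes J: "fractional_ideal \<Delta> J" "J \<inter> \<rat> = \<int>"
  obtains a b where "a > 0" "even (b - \<Delta>)" "J = int_span 1 (quad_surd \<Delta> b / of_int a)"
proof -
  let ?w = "quad_gen \<Delta>"
  obtain m where m: "m > 0" "\<And>x. x \<in> J \<Longrightarrow> of_int m * x \<in> quad_order \<Delta>"
    using fractional_ideal_int_denom[OF J(1)] by blast
  define g where "g = Gcd (surd_coords \<Delta> m J)"
  obtain \<tau> p where \<tau>: "\<tau> \<in> J" "of_int m * \<tau> = of_int p + of_int g * ?w"
    using Gcd_surd_coords[OF J(1), of m] unfolding g_def surd_coords_def by blast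
  have "1 \<in> J"
    using J(2) Ints_1 by blast
  then have "?w * 1 \<in> J"
    by (rule fractional_ideal_scale[OF J(1) quad_gen_in_order])
  then have w: "?w \<in> J" by simp
  then have "m \<in> surd_coords \<Delta> m J"
    unfolding surd_coords_def by (intro CollectI bexI[of _ ?w] exI[of _ 0]) simp_all
  then obtain a where a: "m = g * a"
    unfolding g_def using Gcd_dvd by blast
  have "g \<ge> 0"
    by (simp add: g_def)
  then have "g > 0" "a > 0"
    using m(1) unfolding a by (auto simp: zero_less_mult_iff)
  have "of_int g * (of_int a * \<tau> - ?w) = of_int p"
    using \<tau>(2) unfolding a by (simp add: algebra_simps)
  moreover have "of_int a * \<tau> - ?w \<in> J"
    using fractional_ideal_diff[OF J(1) fractional_ideal_int[OF J(1) \<tau>(1)] w] .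
  ultimately have "of_int a * \<tau> - ?w \<in> \<int>"
    using Ints_if_int_multiple[OF J(2) _ _ \<open>g > 0\<close>] by blast
  then obtain j where "of_int a * \<tau> - ?w = of_int j"
    by (rule Ints_cases)
  then have "of_int a * \<tau> = ?w + of_int j"
    by (simp add: algebra_simps)
  then have "of_int a * \<tau> = quad_surd \<Delta> (\<Delta> + 2 * j)"
    by (simp add: quad_surd_shift quad_gen_eq_quad_surd)
  then have "\<tau> = quad_surd \<Delta> (\<Delta> + 2 * j) / of_int a"
    using \<open>a > 0\<close> by (simp add: field_simps)
  moreover have "J = int_span 1 \<tau>"
    using eq_int_span_if_Gcd_surd_coords[OF J m \<tau>[unfolded g_def]] .
  ultimately show thesis
    using that[of a "\<Delta> + 2 * j"] \<open>a > 0\<close> by simp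
qed

lemma fractional_ideal_eq_form_ideal:
  assumes J: "fractional_ideal \<Delta> J" "J \<inter> \<rat> = \<int>"
  obtains a b c where "a > 0" "quad_form \<Delta> a b c" "(*) (of_int a) ` J = form_ideal \<Delta> a b"
proof -
  obtain a b where a: "a > 0" and parity: "even (b - \<Delta>)"
    and J_eq: "J = int_span 1 (quad_surd \<Delta> b / of_int a)"
    by (rule fractional_ideal_eq_int_span[OF J])
  let ?\<theta> = "quad_surd \<Delta> b"
  have "of_int b - ?\<theta> \<in> quad_order \<Delta>"
    using int_span_memI[of b 1 "- 1" ?\<theta>] by (simp add: quad_order_eq_int_span[OF parity])
  moreover have "?\<theta> / of_int a \<in> J"
    using int_span_memI[of 0 1 1 "?\<theta> / of_int a"] by (simp add: J_eq)
  ultimately have "(of_int b - ?\<theta>) * (?\<theta> / of_int a) \<in> J"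
    by (rule fractional_ideal_scale[OF J(1)])
  also have "(of_int b - ?\<theta>) * (?\<theta> / of_int a) = of_rat (of_int (b\<^sup>2 - \<Delta>) / of_int (4 * a))"
    using a by (simp add: quad_surd_def of_rat_divide of_rat_diff of_rat_mult power2_eq_square field_simps)
  finally have "of_rat (of_int (b\<^sup>2 - \<Delta>) / of_int (4 * a)) \<in> J \<inter> \<rat>" by simp
  then obtain c where "of_rat (of_int (b\<^sup>2 - \<Delta>) / of_int (4 * a)) = (of_int c :: complex)"
    unfolding J(2) by (rule Ints_cases)
  then have "of_int (b\<^sup>2 - \<Delta>) / of_int (4 * a) = (of_int c :: rat)"
    by (metis of_rat_eq_iff of_rat_of_int_eq)
  then have "of_int (b\<^sup>2 - \<Delta>) = (of_int (4 * a * c) :: rat)"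
    using a by (simp add: field_simps)
  then have "b\<^sup>2 - \<Delta> = 4 * a * c"
    by (simp only: of_int_eq_iff)
  then have "quad_form \<Delta> a b c"
    by unfold_locales simp
  moreover have "(*) (of_int a) ` J = form_ideal \<Delta> a b"
    using a by (simp add: J_eq int_span_scale form_ideal_def)
  ultimately show thesis
    using that a by blast
qed

end

context quad_form
begin

lemma quad_form_shift: "quad_form \<Delta> a (b + 2 * a * k) (c + b * k + a * k\<^sup>2)"
  using form_disc by unfold_locales (simp add: power2_eq_square algebra_simps)

lemma reduced_form_bound:
  assumes "\<bar>b\<bar> \<le> a" "a \<le> \<bar>c\<bar>"
  shows "3 * a\<^sup>2 \<le> \<bar>\<Delta>\<bar>"
proof -
  have "a \<ge> 0" using assms(1) by simp
  then have "a * a \<le> a * \<bar>c\<bar>"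
    using assms(2) by (rule mult_left_mono[rotated])
  moreover have "4 * (a * \<bar>c\<bar>) = \<bar>b\<^sup>2 - \<Delta>\<bar>"
    using \<open>a \<ge> 0\<close> by (simp add: abs_mult flip: form_disc)
  moreover have "b\<^sup>2 \<le> a\<^sup>2"
    using assms(1) by (metis abs_le_square_iff abs_of_nonneg \<open>a \<ge> 0\<close>)
  ultimately show ?thesis
    using zero_le_power2[of b] unfolding power2_eq_square[of a] by linarith
qed

lemma normalized_form_ideal_coeff_le:
  assumes J: "normalized_ideal \<Delta> J" and eq: "(*) (of_int a) ` J = form_ideal \<Delta> a b" and "a > 0"
  shows "a \<le> \<bar>c\<bar>"
proof -
  have "quad_surd \<Delta> b \<in> form_ideal \<Delta> a b"
    using form_ideal_memI[of 0 a 1] by simp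
  then obtain t where t: "t \<in> J" "quad_surd \<Delta> b = of_int a * t"
    unfolding eq[symmetric] by auto
  then have "t \<in> quad_field \<Delta>"
    using J by (auto simp: normalized_ideal_def intro: fractional_ideal_field)
  then have "of_int (a * c) = (of_int a)\<^sup>2 * quad_norm \<Delta> t"
    using quad_norm_quad_surd[of 0 1] quad_norm_mult[OF of_int_in_quad_field]
    by (simp add: t(2) quad_norm_of_int)
  then have c: "of_int c = of_int a * quad_norm \<Delta> t"
    using \<open>a > 0\<close> by (simp add: power2_eq_square)
  have "quad_surd \<Delta> b \<noteq> 0"
    using quad_surd_coords_eq_iff[of 0 1 b 0 0] by simp
  then have "1 \<le> \<bar>quad_norm \<Delta> t\<bar>"
    using J t by (auto simp: normalized_ideal_def)
  then have "of_int a * 1 \<le> (of_int a * \<bar>quad_norm \<Delta> t\<bar> :: rat)"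
    using \<open>a > 0\<close> by (intro mult_left_mono) simp_all
  then have "of_int a \<le> (of_int \<bar>c\<bar> :: rat)"
    using \<open>a > 0\<close> by (simp add: c abs_mult)
  then show ?thesis by (simp only: of_int_le_iff)
qed

end

context quad_disc
begin

lemma normalized_ideal_eq_reduced_form_ideal:
  assumes J: "normalized_ideal \<Delta> J"
  obtains a b c where "quad_form \<Delta> a b c" "a > 0" "\<bar>b\<bar> \<le> a" "a \<le> \<bar>c\<bar>"
    "(*) (of_int a) ` J = form_ideal \<Delta> a b"
proof -
  have fJ: "fractional_ideal \<Delta> J"
    using J by (simp add: normalized_ideal_def)
  obtain a b' c' where a: "a > 0" and form': "quad_form \<Delta> a b' c'"
    and J_eq': "(*) (of_int a) ` J = form_ideal \<Delta> a b'"
    by (rule fractional_ideal_eq_form_ideal[OF fJ normalized_ideal_Int_Rats[OF J]])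
  define k where "k = - ((b' + a) div (2 * a))"
  define b c where "b = b' + 2 * a * k" and "c = c' + b' * k + a * k\<^sup>2"
  interpret quad_form \<Delta> a b c
    unfolding b_def c_def by (rule quad_form.quad_form_shift[OF form'])
  have J_eq: "(*) (of_int a) ` J = form_ideal \<Delta> a b"
    by (simp add: b_def form_ideal_shift J_eq')
  have "b + a = (b' + a) mod (2 * a)"
    by (simp add: b_def k_def minus_mult_div_eq_mod[symmetric])
  moreover have "0 \<le> (b' + a) mod (2 * a)" "(b' + a) mod (2 * a) < 2 * a"
    using a by simp_all
  ultimately have "\<bar>b\<bar> \<le> a" by linarith
  moreover have "a \<le> \<bar>c\<bar>"
    by (rule normalized_form_ideal_coeff_le[OF J J_eq a])
  ultimately show thesis
    using that quad_form_axioms a J_eq by blast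
qed

lemma ideal_class_has_reduced_form:
  assumes "C \<in> carrier (class_group \<Delta>)"
  obtains a b c where "quad_form \<Delta> a b c" "a > 0" "\<bar>b\<bar> \<le> a" "a \<le> \<bar>c\<bar>"
    "form_ideal \<Delta> a b \<in> carrier (invertible_ideal_group \<Delta>)"
    "C = ideal_class \<Delta> (form_ideal \<Delta> a b)"
proof -
  obtain I where I: "I \<in> carrier (invertible_ideal_group \<Delta>)" and C: "C = ideal_class \<Delta> I"
    using assms unfolding class_group_carrier by blast
  then have "fractional_ideal \<Delta> I"
    by (simp add: invertible_ideal_carrier)
  then obtain x where x: "x \<in> quad_field \<Delta>" "x \<noteq> 0" and "normalized_ideal \<Delta> ((*) x ` I)"
    by (rule ex_normalized_multiple)
  then obtain a b c where form: "quad_form \<Delta> a b c" "a > 0" "\<bar>b\<bar> \<le> a" "a \<le> \<bar>c\<bar>"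
    and eq: "(*) (of_int a) ` (*) x ` I = form_ideal \<Delta> a b"
    using normalized_ideal_eq_reduced_form_ideal by blast
  have ax: "of_int a * x \<in> quad_field \<Delta>" "of_int a * x \<noteq> 0"
    using x form(2) by (simp_all add: quad_field_mult of_int_in_quad_field)
  have "(*) (of_int a * x) ` I = form_ideal \<Delta> a b"
    using eq by (simp add: image_image mult.assoc)
  then show thesis
    using that[OF form] ideal_class_image_mult[OF I ax] C by simp
qed

lemma finite_class_group: "finite (carrier (class_group \<Delta>))"
proof (rule finite_subset)
  let ?f = "\<lambda>(a, b). ideal_class \<Delta> (form_ideal \<Delta> a b)"
  let ?B = "{0..\<bar>\<Delta>\<bar>} \<times> {- \<bar>\<Delta>\<bar>..\<bar>\<Delta>\<bar>}"
  show "finite (?f ` ?B)" by simp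
  show "carrier (class_group \<Delta>) \<subseteq> ?f ` ?B"
  proof
    fix C assume "C \<in> carrier (class_group \<Delta>)"
    then obtain a b c where form: "quad_form \<Delta> a b c" "a > 0" "\<bar>b\<bar> \<le> a" "a \<le> \<bar>c\<bar>"
      and C: "C = ideal_class \<Delta> (form_ideal \<Delta> a b)"
      by (rule ideal_class_has_reduced_form)
    have "a * 1 \<le> a * a"
      using form(2) by (intro mult_left_mono) auto
    then have "a \<le> \<bar>\<Delta>\<bar>"
      using quad_form.reduced_form_bound[OF form(1,3,4)] unfolding power2_eq_square by linarith
    then have "(a, b) \<in> ?B"
      using form(2,3) by auto
    with C show "C \<in> ?f ` ?B"
      by (intro image_eqI[of _ _ "(a, b)"]) simp_all
  qed
qed

end

lemma quad_discriminant_32: "quad_discriminant 32"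
proof -
  have "32 \<noteq> k\<^sup>2" for k :: int
  proof
    assume k: "32 = k\<^sup>2"
    have "\<bar>k\<bar> < 6" "5 < \<bar>k\<bar>"
      using power2_less_imp_less[of "\<bar>k\<bar>" 6] power2_less_imp_less[of 5 "\<bar>k\<bar>"] by (simp_all flip: k)
    then show False by simp
  qed
  then show ?thesis by (simp add: quad_discriminant_def)
qed

lemma primitive_reduced_form_32:
  fixes a b c :: int
  assumes "b\<^sup>2 - 4 * a * c = 32" "a > 0" "\<bar>b\<bar> \<le> a" "a \<le> \<bar>c\<bar>" "gcd a (gcd b c) = 1"
  shows "a = 1"
proof -
  interpret quad_form 32 a b c
    using assms(1) quad_discriminant_32 by unfold_locales
  have "a\<^sup>2 < 4\<^sup>2"
    using reduced_form_bound[OF assms(3,4)] by simp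
  then have "a < 4"
    by (rule power2_less_imp_less) simp
  then consider "a = 1" | "a = 2" | "a = 3"
    using \<open>a > 0\<close> by linarith
  then show ?thesis
  proof cases
    case 2
    then have "b = -2 \<or> b = -1 \<or> b = 0 \<or> b = 1 \<or> b = 2"
      using assms(3) by presburger
    then have "b = 0" "c = -4"
      using assms(1) 2 by (elim disjE; simp; presburger)+
    then show ?thesis
      using assms(5) 2 by simp
  next
    case 3
    then have "b = -3 \<or> b = -2 \<or> b = -1 \<or> b = 0 \<or> b = 1 \<or> b = 2 \<or> b = 3"
      using assms(3) by presburger
    then have False
      using assms(1) 3 by (elim disjE; simp; presburger)
    then show ?thesis ..
  qed
qed

lemma class_number_32: "class_number 32 = 1"
proof -
  interpret quad_disc 32 by unfold_locales (rule quad_discriminant_32)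
  interpret C: comm_group "class_group 32" by (rule comm_group_class_group)
  have "C = \<one>\<^bsub>class_group 32\<^esub>" if "C \<in> carrier (class_group 32)" for C
  proof -
    obtain a b c where form: "quad_form 32 a b c" "a > 0" "\<bar>b\<bar> \<le> a" "a \<le> \<bar>c\<bar>"
      and inv: "form_ideal 32 a b \<in> carrier (invertible_ideal_group 32)"
      and C: "C = ideal_class 32 (form_ideal 32 a b)"
      using \<open>C \<in> _\<close> by (rule ideal_class_has_reduced_form)
    interpret quad_form 32 a b c by (rule form(1))
    have "a = 1"
      using primitive_reduced_form_32[OF form_disc form(2-4)] invertible_form_ideal_imp_primitive[OF inv] .
    then have "form_ideal 32 a b = quad_order 32"
      by (simp add: form_ideal_def quad_order_eq)
    moreover have "quad_order 32 \<in> principal_ideals 32"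
      using subgroup.one_closed[OF subgroup_principal_ideals] by (simp add: invertible_ideal_group_def)
    ultimately show ?thesis
      using C ideal_class_eq_one_iff[OF inv] by simp
  qed
  then have "carrier (class_group 32) = {\<one>\<^bsub>class_group 32\<^esub>}" by blast
  then show ?thesis by (simp add: class_number_def Coset.order_def)
qed

section \<open>Non-maximal orders\<close>

lemma csqrt_mult_square:
  assumes "f > 0"
  shows "csqrt (of_int (f\<^sup>2 * \<Delta>)) = of_int f * csqrt (of_int \<Delta>)"
proof (rule csqrt_unique)
  show "(of_int f * csqrt (of_int \<Delta>))\<^sup>2 = of_int (f\<^sup>2 * \<Delta>)"
    by (simp add: power_mult_distrib)
  show "0 < Re (of_int f * csqrt (of_int \<Delta>)) \<or>
      Re (of_int f * csqrt (of_int \<Delta>)) = 0 \<and> 0 \<le> Im (of_int f * csqrt (of_int \<Delta>))"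
    using csqrt_principal[of "of_int \<Delta>"] assms by auto
qed

lemma quad_field_mult_square:
  assumes "f > 0"
  shows "quad_field (f\<^sup>2 * \<Delta>) = quad_field \<Delta>"
proof -
  have "of_rat a + of_rat b * csqrt (of_int (f\<^sup>2 * \<Delta>))
      = of_rat a + of_rat (b * of_int f) * csqrt (of_int \<Delta>)"
    "of_rat a + of_rat b * csqrt (of_int \<Delta>)
      = of_rat a + of_rat (b / of_int f) * csqrt (of_int (f\<^sup>2 * \<Delta>))" for a b
    using assms by (simp_all only: csqrt_mult_square) (simp_all add: of_rat_mult of_rat_divide)
  then show ?thesis
    unfolding quad_field_def by blast
qed

context quad_disc
begin

lemma quad_order_finitely_generated:
  "\<exists>B. finite B \<and> quad_order \<Delta> = {\<Sum>x\<in>B. of_int (c x) * x | c. True}"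
proof -
  let ?w = "quad_gen \<Delta>"
  have "?w \<noteq> 1"
    using quad_surd_coords_eq_iff[of 0 1 \<Delta> 1 0] by (simp add: quad_gen_eq_quad_surd)
  then have span: "(\<Sum>x\<in>{1, ?w}. of_int (c x) * x) = of_int (c 1) + of_int (c ?w) * ?w" for c
    by simp
  have "quad_order \<Delta> = {\<Sum>x\<in>{1, ?w}. of_int (c x) * x | c. True}"
    unfolding quad_order_eq[OF discriminant] span
  proof safe
    fix p q :: int
    show "\<exists>c. of_int p + of_int q * ?w = of_int (c 1) + of_int (c ?w) * ?w \<and> True"
      using \<open>?w \<noteq> 1\<close> by (intro exI[of _ "\<lambda>x. if x = 1 then p else q"]) simp
  qed blast
  then show ?thesis
    by (intro exI[of _ "{1, ?w}"]) simp
qed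

lemma quad_field_eq_rat_multiples: "quad_field \<Delta> = {of_rat q * x | q x. x \<in> quad_order \<Delta>}"
proof
  show "{of_rat q * x | q x. x \<in> quad_order \<Delta>} \<subseteq> quad_field \<Delta>"
    using quad_field_mult[OF quad_field_Rat] quad_order_subset_field by blast
  show "quad_field \<Delta> \<subseteq> {of_rat q * x | q x. x \<in> quad_order \<Delta>}"
  proof
    fix z assume z: "z \<in> quad_field \<Delta>"
    show "z \<in> {of_rat q * x | q x. x \<in> quad_order \<Delta>}"
    proof (cases "z = 0")
      case True
      then show ?thesis using quad_order_0 by force
    next
      case False
      obtain m where m: "m > 0" "of_int m * z \<in> quad_order \<Delta>"
        using fractional_ideal_int_denom[OF fractional_ideal_principal[OF z False]] quad_order_1
        by (metis imageI mult.right_neutral)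
      then have "z = of_rat (1 / of_int m) * (of_int m * z)"
        by (simp add: of_rat_divide)
      then show ?thesis using m(2) by blast
    qed
  qed
qed

lemma order_in_quad_field_quad_order: "order_in_quad_field \<Delta> (quad_order \<Delta>)"
  unfolding order_in_quad_field_def
  using quad_order_subset_field quad_order_1 quad_order_mult
    fractional_ideal_diff[OF fractional_ideal_order] quad_order_finitely_generated
    quad_field_eq_rat_multiples
  by blast

end

lemma quad_order_not_maximal:
  assumes big: "quad_discriminant (f\<^sup>2 * \<Delta>)" and \<Delta>: "\<Delta> mod 4 = 0 \<or> \<Delta> mod 4 = 1" and "f > 1"
  shows "\<not> maximal_order (f\<^sup>2 * \<Delta>) (quad_order (f\<^sup>2 * \<Delta>))"
proof
  let ?R = "quad_order (f\<^sup>2 * \<Delta>)"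
  assume max: "maximal_order (f\<^sup>2 * \<Delta>) ?R"
  have "\<Delta> \<noteq> k\<^sup>2" for k
    using big unfolding quad_discriminant_def by (metis power_mult_distrib)
  then interpret quad_disc \<Delta>
    using \<Delta> by unfold_locales (simp add: quad_discriminant_def)
  have f: "f > 0" using \<open>f > 1\<close> by simp
  have "even (f\<^sup>2 * \<Delta> - f * \<Delta>)" by simp
  then obtain j where "f\<^sup>2 * \<Delta> - f * \<Delta> = 2 * j" by blast
  then have j: "f\<^sup>2 * \<Delta> = f * \<Delta> + 2 * j" by simp
  have gen_coords: "of_int p + of_int q * quad_gen (f\<^sup>2 * \<Delta>)
      = of_int (p + q * j) + of_int (q * f) * quad_gen \<Delta>" for p q
    unfolding quad_gen_def csqrt_mult_square[OF f] unfolding j by (simp add: field_simps)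
  have "?R \<subseteq> quad_order \<Delta>"
    unfolding quad_order_eq[OF big] quad_order_eq[OF discriminant] using gen_coords by blast
  moreover have "order_in_quad_field (f\<^sup>2 * \<Delta>) (quad_order \<Delta>)"
    using order_in_quad_field_quad_order
    unfolding order_in_quad_field_def quad_field_mult_square[OF f] .
  ultimately have "quad_order \<Delta> = ?R"
    using max by (simp add: maximal_order_def)
  then have "quad_gen \<Delta> \<in> ?R"
    using quad_gen_in_order[of \<Delta>] by metis
  then obtain p q where "quad_gen \<Delta> = of_int p + of_int q * quad_gen (f\<^sup>2 * \<Delta>)"
    unfolding quad_order_eq[OF big] by blast
  then have "q * f = 1"
    unfolding gen_coords using quad_surd_coords_eq_iff[of 0 1 \<Delta> _ "q * f"]
    by (metis add_0 mult_1 of_int_0 of_int_1 quad_gen_eq_quad_surd)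
  then show False
    using \<open>f > 1\<close> zmult_eq_1_iff by simp
qed

section \<open>Discriminants of the form \<open>4 (m\<^sup>2 - 1)\<close>\<close>

lemma ambiguous_form_ideal_not_principal:
  assumes form: "quad_form (4 * (m\<^sup>2 - 1)) a a c" and a: "1 < a" "a < 2 * (m - 1)"
  shows "form_ideal (4 * (m\<^sup>2 - 1)) a a \<notin> principal_ideals (4 * (m\<^sup>2 - 1))"
proof
  interpret quad_form "4 * (m\<^sup>2 - 1)" a a c by (rule form)
  assume "form_ideal (4 * (m\<^sup>2 - 1)) a a \<in> principal_ideals (4 * (m\<^sup>2 - 1))"
  then obtain x y where unit: "\<bar>a * x\<^sup>2 + a * x * y + c * y\<^sup>2\<bar> = 1" (is "\<bar>?v\<bar> = 1")
    using principal_form_ideal_represents_unit by blast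
  obtain h where h: "a = 2 * h"
    using middle_coeff_parity by fastforce
  have "4 * (a * c) = 4 * (h\<^sup>2 - (m\<^sup>2 - 1))"
    using form_disc by (simp add: h power2_eq_square)
  then have ac: "a * c = h\<^sup>2 - (m\<^sup>2 - 1)" by simp
  have "a * ?v = a * a * x\<^sup>2 + a * a * x * y + (a * c) * y\<^sup>2"
    by (simp add: algebra_simps)
  also have "\<dots> = (a * x + h * y)\<^sup>2 - (m\<^sup>2 - 1) * y\<^sup>2"
    unfolding ac by (simp add: h power2_eq_square algebra_simps)
  finally have value_eq: "a * ?v = (a * x + h * y)\<^sup>2 - (m\<^sup>2 - 1) * y\<^sup>2" .
  have "\<bar>a * ?v\<bar> = a"
    using a(1) unit by (simp add: abs_mult)
  then obtain r where r: "a * ?v = r\<^sup>2" "r dvd y"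
    using small_pell_value_square[of "a * x + h * y" m y] a(2) unfolding value_eq by auto
  then have "r\<^sup>2 = a"
    using \<open>\<bar>a * ?v\<bar> = a\<close> by (metis abs_power2)
  then have "a dvd y\<^sup>2"
    using r(2) by (metis dvd_power_same)
  then have "a dvd ?v" by simp
  then have "a dvd 1"
    using unit by (metis dvd_abs_iff)
  then show False using a(1) by simp
qed

lemma even_class_number_if_small_ambiguous:
  assumes "quad_form (4 * (m\<^sup>2 - 1)) a a c" "coprime a c" "1 < a" "a < 2 * (m - 1)"
  shows "even (class_number (4 * (m\<^sup>2 - 1)))"
proof -
  interpret quad_form "4 * (m\<^sup>2 - 1)" a a c by (rule assms(1))
  show ?thesis
    using assms(2) ambiguous_form_ideal_not_principal[OF assms(1,3,4)]
    by (intro even_class_number_if_ambiguous finite_class_group) simp_all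
qed

lemma quad_order_not_maximal_if_odd_m:
  assumes "quad_discriminant (4 * (m\<^sup>2 - 1))" "odd m"
  shows "\<not> maximal_order (4 * (m\<^sup>2 - 1)) (quad_order (4 * (m\<^sup>2 - 1)))"
proof -
  obtain k where "m = 2 * k + 1" using \<open>odd m\<close> by (rule oddE)
  then have "4 * (m\<^sup>2 - 1) = 2\<^sup>2 * (4 * (k * (k + 1)))"
    by (simp add: power2_eq_square algebra_simps)
  then show ?thesis
    using quad_order_not_maximal[of 2 "4 * (k * (k + 1))"] assms(1) by simp
qed

lemma even_class_number_if_even_m:
  assumes "quad_discriminant (4 * (m\<^sup>2 - 1))" "even m" "m \<ge> 3"
  shows "even (class_number (4 * (m\<^sup>2 - 1)))"
proof -
  obtain h where h: "m = 2 * h" using \<open>even m\<close> by blast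
  have "quad_form (4 * (m\<^sup>2 - 1)) 2 2 (1 - 2 * h\<^sup>2)"
    using assms(1) by unfold_locales (simp_all add: h power_mult_distrib)
  moreover have "coprime 2 (1 - 2 * h\<^sup>2)" by simp
  ultimately show ?thesis
    by (rule even_class_number_if_small_ambiguous) (use \<open>m \<ge> 3\<close> in simp_all)
qed

lemma even_class_number_if_odd_m:
  assumes "quad_discriminant (4 * (m\<^sup>2 - 1))" "odd m" "m > 3"
  shows "even (class_number (4 * (m\<^sup>2 - 1)))"
proof -
  obtain k where k: "m = 2 * k + 1" using \<open>odd m\<close> by (rule oddE)
  have "quad_form (4 * (m\<^sup>2 - 1)) 4 4 (1 - k * (k + 1))"
    using assms(1) by unfold_locales (simp_all add: k power2_eq_square algebra_simps)
  moreover have "coprime 4 (1 - k * (k + 1))"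
    using coprime_power_left_iff[of 2 2 "1 - k * (k + 1)"] by simp
  ultimately show ?thesis
    by (rule even_class_number_if_small_ambiguous) (use \<open>m > 3\<close> in simp_all)
qed

theorem theorem4p5:
  fixes n \<Delta> :: int
  assumes "n \<ge> 0" and "\<Delta> = n\<^sup>2 - 4" and "quad_discriminant \<Delta>"
  shows "(\<forall>m. maximal_order \<Delta> (quad_order \<Delta>) \<and> n = 2 * m \<and> class_number \<Delta> = 1 \<longrightarrow>
            m \<in> {0, 2} \<and> n \<in> {0, 4} \<and> \<Delta> \<in> {-4, 12}) \<and>
         (\<forall>m. n mod 4 = 2 \<and> n = 2 * m \<longrightarrow>
            (m > 3 \<longrightarrow> finite (carrier (class_group \<Delta>)) \<and> even (class_number \<Delta>)) \<and>
            (m = 3 \<longrightarrow> \<Delta> = 32 \<and> class_number \<Delta> = 1))"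
proof (intro conjI allI impI)
  have disc: "\<Delta> = 4 * (m\<^sup>2 - 1)" if "n = 2 * m" for m
    using that assms(2) by (simp add: power_mult_distrib)
  fix m
  {
    assume m: "maximal_order \<Delta> (quad_order \<Delta>) \<and> n = 2 * m \<and> class_number \<Delta> = 1"
    then have "even m"
      using quad_order_not_maximal_if_odd_m disc assms(3) by blast
    moreover have "\<not> m \<ge> 3"
      using even_class_number_if_even_m[of m] \<open>even m\<close> disc[of m] m assms(3) by auto
    ultimately have "m = 0 \<or> m = 2"
      using m assms(1) by presburger
    then show "m \<in> {0, 2}" "n \<in> {0, 4}" "\<Delta> \<in> {-4, 12}"
      using m disc[of m] by auto
  next
    assume m: "n mod 4 = 2 \<and> n = 2 * m"
    then have "odd m" by presburger
    show "finite (carrier (class_group \<Delta>))"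
      using assms(3) by (rule quad_disc.finite_class_group[OF quad_disc.intro])
    show "even (class_number \<Delta>)" if "m > 3"
      using even_class_number_if_odd_m[OF _ \<open>odd m\<close> that] disc[of m] m assms(3) by simp
    show "\<Delta> = 32" if "m = 3"
      using that disc[of m] m by simp
    then show "class_number \<Delta> = 1" if "m = 3"
      using that class_number_32 by simp
  }
qed

end
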